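(* Let $M\in\Sigma_s\subset\mathrm{Hom}(\mathbb{C}^n,\mathbb{C}^{n+k})$ with $s>r$. Then the fiber at $M$ of the conormal space $C(\overline{\Sigma}_r)$ is $X_{s-r}(M)$.
   Context: $\Sigma_r\subset\mathrm{Hom}(\mathbb{C}^n,\mathbb{C}^{n+k})$ is the set of matrices of kernel rank $r$ (kernel of dimension exactly $r$), and $\overline{\Sigma}_r$ is the set of matrices of kernel rank $r$ or more. The conormal space $C(\overline{\Sigma}_r)\subset\overline{\Sigma}_r\times\mathbb{P}^{n(n+k)-1}$ is the closure of the set of pairs (smooth point, tangent hyperplane at that point); a hyperplane is represented by a matrix $L$, acting as the linear form $B\mapsto\sum_{i,j}L_{ij}B_{ij}$ on $\mathrm{Hom}(\mathbb{C}^n,\mathbb{C}^{n+k})$. For $M\in\mathrm{Hom}(\mathbb{C}^n,\mathbb{C}^{n+k})$, $K(M)\subset\mathbb{C}^n$ is the kernel of $M$ and $C(M)$ is the cokernel, thought of as the space of vectors in $\mathbb{C}^{n+k}$ annihilating the image of $M$ (under the standard bilinear form). The fiber of $C(\overline{\Sigma}_r)$ at $M$ lies in the projectivization of the space of matrices $L$ all of whose columns lie in $C(M)$ and all of whose rows lie in $K(M)$; up to standard linear identifications (which preserve rank) this space is $\mathrm{Hom}(K(M),C(M))$. $\Sigma_t(M)$ denotes the set of elements of $\mathrm{Hom}(K(M),C(M))$ of kernel rank $t$, $\overline{\Sigma}_t(M)$ its closure (kernel rank at least $t$), and $X_t(M)=\mathbb{P}(\overline{\Sigma}_t(M))\subset\mathbb{P}\mathrm{Hom}(K(M),C(M))$.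 *)

theory Defs
  imports "HOL-Analysis.Analysis"
begin

section \<open>Matrices as a complex vector space\<close>

text \<open>
  The library only makes \<open>complex ^ 'n ^ 'm\<close> a real vector space, so the complex scalar
  multiplication is added here. A matrix with \<open>CARD('m)\<close> rows and \<open>CARD('n)\<close> columns is an element
  of the space of linear maps from \<open>complex ^ 'n\<close> to \<open>complex ^ 'm\<close>.
\<close>

definition cscale :: "complex \<Rightarrow> complex ^ 'n ^ 'm \<Rightarrow> complex ^ 'n ^ 'm" where
  "cscale c A = (\<chi> i j. c * A $ i $ j)"

interpretation cmat: vector_space "cscale :: complex \<Rightarrow> complex ^ 'n ^ 'm \<Rightarrow> complex ^ 'n ^ 'm"
  by unfold_locales (simp_all add: cscale_def vec_eq_iff algebra_simps)

definition mat_pairing :: "complex ^ 'n ^ 'm \<Rightarrow> complex ^ 'n ^ 'm \<Rightarrow> complex" where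
  "mat_pairing L B = (\<Sum>i\<in>UNIV. \<Sum>j\<in>UNIV. L $ i $ j * B $ i $ j)"

section \<open>Kernel, cokernel and kernel rank\<close>

definition ker :: "complex ^ 'n ^ 'm \<Rightarrow> (complex ^ 'n) set" where
  "ker M = {x. M *v x = 0}"

text \<open>The bilinear form is the standard one, without complex conjugation.\<close>

definition coker :: "complex ^ 'n ^ 'm \<Rightarrow> (complex ^ 'm) set" where
  "coker M = {y. \<forall>x. (\<Sum>i\<in>UNIV. y $ i * (M *v x) $ i) = 0}"

definition Sigma_eq :: "nat \<Rightarrow> (complex ^ 'n ^ 'm) set" where
  "Sigma_eq r = {M. vec.dim (ker M) = r}"

definition Sigma_bar :: "nat \<Rightarrow> (complex ^ 'n ^ 'm) set" where
  "Sigma_bar r = {M. vec.dim (ker M) \<ge> r}"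

section \<open>Smooth points and tangent spaces\<close>

definition holomorphic_mat_on ::
    "(complex ^ 'n ^ 'm \<Rightarrow> complex ^ 'n ^ 'm) \<Rightarrow> (complex ^ 'n ^ 'm) set \<Rightarrow> bool" where
  "holomorphic_mat_on f U \<longleftrightarrow>
     (\<forall>x\<in>U. \<exists>f'. (f has_derivative f') (at x) \<and> (\<forall>c A. f' (cscale c A) = cscale c (f' A)))"

text \<open>
  A point of a subset \<open>X\<close> is smooth if \<open>X\<close> is a complex submanifold near that point: some
  biholomorphic change of coordinates \<open>\<phi>\<close> (with inverse \<open>\<psi>\<close>) between open sets maps \<open>X\<close> to a
  complex linear subspace \<open>W\<close>. For an algebraic subset this is smoothness of the reduced variety.
\<close>

definition smooth_point :: "(complex ^ 'n ^ 'm) set \<Rightarrow> complex ^ 'n ^ 'm \<Rightarrow> bool" where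
  "smooth_point X x \<longleftrightarrow> x \<in> X \<and>
     (\<exists>U \<phi> \<psi> W. open U \<and> x \<in> U \<and> open (\<phi> ` U) \<and>
        holomorphic_mat_on \<phi> U \<and> holomorphic_mat_on \<psi> (\<phi> ` U) \<and> (\<forall>y\<in>U. \<psi> (\<phi> y) = y) \<and>
        cmat.subspace W \<and> \<phi> ` (X \<inter> U) = \<phi> ` U \<inter> W)"

text \<open>
  Velocities at \<open>x\<close> of curves in \<open>X\<close>. At a smooth point this is the tangent space of the complex
  submanifold; it is only used there.
\<close>

definition tangent_space :: "(complex ^ 'n ^ 'm) set \<Rightarrow> complex ^ 'n ^ 'm \<Rightarrow> (complex ^ 'n ^ 'm) set" where
  "tangent_space X x =
     {v. \<exists>\<gamma>::real \<Rightarrow> complex ^ 'n ^ 'm.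
           \<gamma> 0 = x \<and> (\<forall>\<^sub>F t in nhds 0. \<gamma> t \<in> X) \<and> (\<gamma> has_vector_derivative v) (at 0)}"

text \<open>
  The hyperplane of all \<open>B\<close> with \<open>mat_pairing L B = 0\<close>, for nonzero \<open>L\<close>, is tangent if it contains
  the tangent space.
\<close>

definition tangent_hyperplane ::
    "(complex ^ 'n ^ 'm) set \<Rightarrow> complex ^ 'n ^ 'm \<Rightarrow> complex ^ 'n ^ 'm \<Rightarrow> bool" where
  "tangent_hyperplane X x L \<longleftrightarrow> L \<noteq> 0 \<and> tangent_space X x \<subseteq> {B. mat_pairing L B = 0}"

section \<open>Projective space and the conormal space\<close>

text \<open>Points of projective space are the complex lines through the origin.\<close>

definition projectivization :: "(complex ^ 'n ^ 'm) set \<Rightarrow> (complex ^ 'n ^ 'm) set set" where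
  "projectivization S = {cmat.span {L} | L. L \<in> S \<and> L \<noteq> 0}"

text \<open>The quotient topology under the map from nonzero matrices to lines.\<close>

definition proj_topology :: "(complex ^ 'n ^ 'm) set topology" where
  "proj_topology =
     topology (\<lambda>V. V \<subseteq> projectivization UNIV \<and> open {L. L \<noteq> 0 \<and> cmat.span {L} \<in> V})"

lemma openin_proj_topology:
  fixes V :: "(complex ^ 'n ^ 'm) set set"
  shows "openin proj_topology V \<longleftrightarrow>
     V \<subseteq> projectivization UNIV \<and> open {L. L \<noteq> 0 \<and> cmat.span {L} \<in> V}"
proof -
  have "istopology (\<lambda>V::(complex ^ 'n ^ 'm) set set.
          V \<subseteq> projectivization UNIV \<and> open {L. L \<noteq> 0 \<and> cmat.span {L} \<in> V})"
    unfolding istopology_def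
  proof (intro conjI allI impI)
    fix S T :: "(complex ^ 'n ^ 'm) set set"
    assume S: "S \<subseteq> projectivization UNIV \<and> open {L. L \<noteq> 0 \<and> cmat.span {L} \<in> S}"
      and T: "T \<subseteq> projectivization UNIV \<and> open {L. L \<noteq> 0 \<and> cmat.span {L} \<in> T}"
    show "S \<inter> T \<subseteq> projectivization UNIV" using S by blast
    have "{L. L \<noteq> 0 \<and> cmat.span {L} \<in> S \<inter> T} =
          {L. L \<noteq> 0 \<and> cmat.span {L} \<in> S} \<inter> {L. L \<noteq> 0 \<and> cmat.span {L} \<in> T}" by blast
    then show "open {L. L \<noteq> 0 \<and> cmat.span {L} \<in> S \<inter> T}" using S T by (simp add: open_Int)
  next
    fix \<K> :: "(complex ^ 'n ^ 'm) set set set"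
    assume K: "\<forall>K\<in>\<K>. K \<subseteq> projectivization UNIV \<and> open {L. L \<noteq> 0 \<and> cmat.span {L} \<in> K}"
    show "\<Union>\<K> \<subseteq> projectivization UNIV" using K by blast
    have "{L. L \<noteq> 0 \<and> cmat.span {L} \<in> \<Union>\<K>} =
          (\<Union>K\<in>\<K>. {L. L \<noteq> 0 \<and> cmat.span {L} \<in> K})" by blast
    then show "open {L. L \<noteq> 0 \<and> cmat.span {L} \<in> \<Union>\<K>}" using K by (simp add: open_UN)
  qed
  then show ?thesis
    by (simp add: proj_topology_def topology_inverse')
qed

definition conormal_space ::
    "(complex ^ 'n ^ 'm) set \<Rightarrow> ((complex ^ 'n ^ 'm) \<times> (complex ^ 'n ^ 'm) set) set" where
  "conormal_space X =
     prod_topology (top_of_set X) proj_topology closure_of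
       {(x, cmat.span {L}) | x L. smooth_point X x \<and> tangent_hyperplane X x L}"

definition conormal_fiber ::
    "(complex ^ 'n ^ 'm) set \<Rightarrow> complex ^ 'n ^ 'm \<Rightarrow> (complex ^ 'n ^ 'm) set set" where
  "conormal_fiber X M = {p. (M, p) \<in> conormal_space X}"

section \<open>Linear maps from the kernel to the cokernel\<close>

definition Hom_ker_coker :: "complex ^ 'n ^ 'm \<Rightarrow> (complex ^ 'n \<Rightarrow> complex ^ 'm) set" where
  "Hom_ker_coker M =
     {f \<in> ker M \<rightarrow>\<^sub>E coker M.
        (\<forall>x\<in>ker M. \<forall>y\<in>ker M. f (x + y) = f x + f y) \<and> (\<forall>c. \<forall>x\<in>ker M. f (c *s x) = c *s f x)}"

definition Sigma_eq_at :: "complex ^ 'n ^ 'm \<Rightarrow> nat \<Rightarrow> (complex ^ 'n \<Rightarrow> complex ^ 'm) set" where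
  "Sigma_eq_at M t = {f \<in> Hom_ker_coker M. vec.dim {x \<in> ker M. f x = 0} = t}"

text \<open>
  The closure is taken for pointwise convergence of functions, which on the finite-dimensional
  space \<open>Hom_ker_coker M\<close> (a closed set of functions) is the usual topology.
\<close>

definition Sigma_bar_at :: "complex ^ 'n ^ 'm \<Rightarrow> nat \<Rightarrow> (complex ^ 'n \<Rightarrow> complex ^ 'm) set" where
  "Sigma_bar_at M t = closure (Sigma_eq_at M t)"

definition conormal_matrices :: "complex ^ 'n ^ 'm \<Rightarrow> (complex ^ 'n ^ 'm) set" where
  "conormal_matrices M = {L. (\<forall>j. column j L \<in> coker M) \<and> (\<forall>i. row i L \<in> ker M)}"

text \<open>
  A basis \<open>B\<close> of \<open>ker M\<close> identifies \<open>ker M\<close> with its dual and hence \<open>Hom_ker_coker M\<close> with the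
  matrices whose columns lie in \<open>coker M\<close> and whose rows lie in \<open>ker M\<close>: a map \<open>f\<close> corresponds to
  the sum over \<open>b \<in> B\<close> of the products of the column vector \<open>f b\<close> with the row vector \<open>b\<close>.
\<close>

definition is_basis_of :: "(complex ^ 'n) set \<Rightarrow> (complex ^ 'n) set \<Rightarrow> bool" where
  "is_basis_of B V \<longleftrightarrow> vec.independent B \<and> vec.span B = V"

definition hom_to_matrix ::
    "(complex ^ 'n) set \<Rightarrow> (complex ^ 'n \<Rightarrow> complex ^ 'm) \<Rightarrow> complex ^ 'n ^ 'm" where
  "hom_to_matrix B f = (\<Sum>b\<in>B. \<chi> i j. f b $ i * b $ j)"

definition X_at :: "(complex ^ 'n) set \<Rightarrow> complex ^ 'n ^ 'm \<Rightarrow> nat \<Rightarrow> (complex ^ 'n ^ 'm) set set" where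
  "X_at B M t = projectivization (hom_to_matrix B ` Sigma_bar_at M t)"

lemma hom_to_matrix_nth: "hom_to_matrix B f $ i $ j = (\<Sum>b\<in>B. f b $ i * b $ j)"
  by (simp add: hom_to_matrix_def)

lemma subspace_coker: "vec.subspace (coker M)"
  unfolding vec.subspace_def coker_def
  by (auto simp: algebra_simps sum.distrib simp flip: sum_distrib_left)

lemma Hom_ker_coker_sum:
  assumes f: "f \<in> Hom_ker_coker M" and "finite A" "A \<subseteq> ker M"
  shows "f (\<Sum>b\<in>A. c b *s b) = (\<Sum>b\<in>A. c b *s f b) \<and> (\<Sum>b\<in>A. c b *s b) \<in> ker M"
  using assms(2,3)
proof (induction A)
  case empty
  have "0 \<in> ker M" by (simp add: ker_def)
  then have "f (0 *s 0) = 0 *s f 0" using f unfolding Hom_ker_coker_def by blast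
  then show ?case by (simp add: ker_def)
next
  case (insert a A)
  have a: "c a *s a \<in> ker M"
    using insert.prems by (simp add: ker_def vector_scalar_commute)
  have IH: "f (\<Sum>b\<in>A. c b *s b) = (\<Sum>b\<in>A. c b *s f b)" "(\<Sum>b\<in>A. c b *s b) \<in> ker M"
    using insert by blast+
  have "f (c a *s a + (\<Sum>b\<in>A. c b *s b)) = c a *s f a + (\<Sum>b\<in>A. c b *s f b)"
    using f a IH insert.prems unfolding Hom_ker_coker_def by simp
  moreover have "c a *s a + (\<Sum>b\<in>A. c b *s b) \<in> ker M"
    using a IH(2) by (simp add: ker_def matrix_vector_right_distrib)
  ultimately show ?case using insert.hyps by simp
qed

lemma bij_betw_hom_to_matrix:
  assumes B: "is_basis_of B (ker M)"
  shows "bij_betw (hom_to_matrix B) (Hom_ker_coker M) (conormal_matrices M)"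
proof -
  have ind: "vec.independent B" and sp: "vec.span B = ker M"
    using B by (auto simp: is_basis_of_def)
  have fin: "finite B" using ind by (rule vec.finiteI_independent)
  have Bk: "B \<subseteq> ker M" using vec.span_superset[of B] sp by simp
  let ?rep = "vec.representation B"
  have rep: "(\<Sum>b\<in>B. ?rep x b *s b) = x" if "x \<in> ker M" for x
    using vec.sum_representation_eq[OF ind _ fin order_refl] that sp by simp
  have zero: "c b = 0" if "(\<Sum>b\<in>B. c b *s b) = 0" "b \<in> B" for c b
    using vec.independentD[OF ind fin order_refl] that by blast
  show ?thesis
    unfolding bij_betw_def
  proof (intro conjI inj_onI equalityI subsetI)
    fix f g assume f: "f \<in> Hom_ker_coker M" and g: "g \<in> Hom_ker_coker M"
      and eq: "hom_to_matrix B f = hom_to_matrix B g"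
    have fg: "f b = g b" if b: "b \<in> B" for b
    proof -
      have "f b $ i - g b $ i = 0" for i
      proof (rule zero[OF _ b])
        have "(\<Sum>b\<in>B. f b $ i * b $ j) = (\<Sum>b\<in>B. g b $ i * b $ j)" for j
          using arg_cong[OF eq, of "\<lambda>A. A $ i $ j"] by (simp add: hom_to_matrix_nth)
        then show "(\<Sum>b\<in>B. (f b $ i - g b $ i) *s b) = 0"
          by (simp add: vec_eq_iff left_diff_distrib sum_subtractf)
      qed
      then show ?thesis by (simp add: vec_eq_iff)
    qed
    show "f = g"
    proof (rule PiE_ext)
      show "f \<in> ker M \<rightarrow>\<^sub>E coker M" "g \<in> ker M \<rightarrow>\<^sub>E coker M"
        using f g by (auto simp: Hom_ker_coker_def)
      fix x assume "x \<in> ker M"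
      then have x: "(\<Sum>b\<in>B. ?rep x b *s b) = x" by (rule rep)
      have "f x = (\<Sum>b\<in>B. ?rep x b *s f b)" "g x = (\<Sum>b\<in>B. ?rep x b *s g b)"
        using Hom_ker_coker_sum[OF f fin Bk, of "?rep x"] Hom_ker_coker_sum[OF g fin Bk, of "?rep x"]
        unfolding x by blast+
      then show "f x = g x" using fg by simp
    qed
  next
    fix L assume "L \<in> hom_to_matrix B ` Hom_ker_coker M"
    then obtain f where f: "f \<in> Hom_ker_coker M" and L: "L = hom_to_matrix B f" by blast
    have "row i L = (\<Sum>b\<in>B. f b $ i *s b)" for i
      by (simp add: L vec_eq_iff row_def hom_to_matrix_nth)
    then have r: "row i L \<in> ker M" for i
      using Hom_ker_coker_sum[OF f fin Bk, of "\<lambda>b. f b $ i"] by simp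
    have "column j L = (\<Sum>b\<in>B. b $ j *s f b)" for j
      by (simp add: L vec_eq_iff column_def hom_to_matrix_nth mult.commute)
    moreover have "f b \<in> coker M" if "b \<in> B" for b
      using f that Bk by (auto simp: Hom_ker_coker_def)
    ultimately have "column j L \<in> coker M" for j
      by (simp add: vec.subspace_sum vec.subspace_scale subspace_coker)
    with r show "L \<in> conormal_matrices M" by (simp add: conormal_matrices_def)
  next
    fix L assume "L \<in> conormal_matrices M"
    then have cl: "column j L \<in> coker M" and rw: "row i L \<in> ker M" for i j
      by (auto simp: conormal_matrices_def)
    define F where "F b = (\<chi> i. ?rep (row i L) b)" for b
    define f where "f = restrict (\<lambda>x. \<Sum>b\<in>B. ?rep x b *s F b) (ker M)"
    have F: "F b \<in> coker M" if b: "b \<in> B" for b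
      unfolding coker_def
    proof (intro CollectI allI)
      fix x
      let ?c = "\<lambda>b. \<Sum>i\<in>UNIV. F b $ i * (M *v x) $ i"
      have "(\<Sum>b\<in>B. ?c b *s b) = (\<Sum>i\<in>UNIV. (M *v x) $ i *s (\<Sum>b\<in>B. ?rep (row i L) b *s b))"
        by (simp add: vec_eq_iff F_def sum_distrib_left sum_distrib_right mult.assoc
            mult.left_commute) (use sum.swap in fast)
      also have "\<dots> = (\<Sum>i\<in>UNIV. (M *v x) $ i *s row i L)" by (simp add: rep rw)
      also have "\<dots> = 0"
        using cl by (simp add: vec_eq_iff coker_def row_def column_def mult.commute)
      finally show "?c b = 0" using zero[of ?c b] b by simp
    qed
    have "f \<in> Hom_ker_coker M"
      unfolding Hom_ker_coker_def
    proof (intro CollectI conjI ballI allI)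
      show "f \<in> ker M \<rightarrow>\<^sub>E coker M"
        unfolding f_def using F
        by (auto intro!: vec.subspace_sum vec.subspace_scale subspace_coker)
    next
      fix x y assume xy: "x \<in> ker M" "y \<in> ker M"
      then have "x + y \<in> ker M" by (simp add: ker_def matrix_vector_right_distrib)
      then show "f (x + y) = f x + f y"
        using xy ind sp
        by (simp add: f_def vec.representation_add vec.scale_left_distrib sum.distrib)
    next
      fix c x assume x: "x \<in> ker M"
      then have "c *s x \<in> ker M" by (simp add: ker_def vector_scalar_commute)
      then show "f (c *s x) = c *s f x"
        using x ind sp
        by (simp add: f_def vec.representation_scale vec.scale_sum_right)
    qed
    moreover have "f b = F b" if b: "b \<in> B" for b
    proof -
      have "f b = (\<Sum>b'\<in>B. (if b' = b then F b' else 0))"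
        using b Bk ind by (auto simp: f_def vec.representation_basis intro!: sum.cong)
      then show ?thesis using b fin by simp
    qed
    then have "hom_to_matrix B f $ i $ j = (\<Sum>b\<in>B. ?rep (row i L) b *s b) $ j" for i j
      by (simp add: hom_to_matrix_nth F_def)
    then have "hom_to_matrix B f $ i $ j = row i L $ j" for i j
      using rep[OF rw] by metis
    then have "hom_to_matrix B f = L" by (simp add: vec_eq_iff row_def)
    ultimately show "L \<in> hom_to_matrix B ` Hom_ker_coker M" by blast
  qed
qed

end

theory Submission
  imports Defs
begin

text \<open>
  Over points \<open>x\<close> of kernel rank exactly \<open>r\<close> the conormal space of \<open>Sigma_bar r\<close> is explicit.
  Near \<open>x\<close> the matrices of kernel rank \<open>r\<close> or more are those whose Schur complement with
  respect to \<open>x\<close> vanishes. Replacing the lower right block of a matrix by its Schur complement is a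
  biholomorphic change of coordinates, so \<open>x\<close> is a smooth point, and the tangent directions \<open>v\<close> at
  \<open>x\<close> satisfy \<open>y\<^sup>T v z = 0\<close> for \<open>y\<close> in the cokernel and \<open>z\<close> in the kernel. The hyperplane of
  \<open>L\<close> is therefore tangent at \<open>x\<close> exactly if the rows of \<open>L\<close> lie in the kernel of \<open>x\<close> and its
  columns in the cokernel, which is \<open>x L\<^sup>T = 0\<close> and \<open>L\<^sup>T x = 0\<close>. At a point of larger kernel
  rank every line in the direction of a rank one matrix stays in \<open>Sigma_bar r\<close>, so no hyperplane is
  tangent there, whether or not the point is smooth. This is \<open>conormal_pair_iff\<close>.

  For such a pair \<open>(x, L)\<close> the rank of \<open>L\<close> is at most \<open>r\<close>, because the row space of \<open>L\<close> lies in the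
  kernel of \<open>x\<close>. Both the orthogonality relations and the bound on the rank are closed conditions, so
  they persist at a limit \<open>(M, L)\<close>. Conversely let \<open>L\<close> be orthogonal to \<open>M\<close> in this sense with
  rank at most \<open>r\<close>. Choose a subspace \<open>S\<close> of dimension \<open>r\<close> between the row space of \<open>L\<close> and the
  kernel of \<open>M\<close>. A direction \<open>N\<close> with values in the annihilator of the columns of \<open>L\<close> can be chosen
  such that \<open>M + t N\<close> has kernel exactly \<open>S\<close> for all nonzero \<open>t\<close> (\<open>exists_kernel_perturbation\<close>, a
  dimension count that uses that there are at least as many rows as columns). Then \<open>(M + t N, L)\<close> is
  a conormal pair and tends to \<open>(M, L)\<close>. Hence the fiber at \<open>M\<close> consists of the classes of the
  matrices of rank at most \<open>r\<close> in \<open>conormal_matrices M\<close> (\<open>closure_conormal_pairs\<close>).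

  Finally, a linear map \<open>f\<close> from the kernel of \<open>M\<close>, which has dimension \<open>s\<close>, to its cokernel has the
  same rank as the matrix \<open>hom_to_matrix B f\<close>, so rank at most \<open>r\<close> means kernel rank at least
  \<open>s - r\<close>. The perturbation lemma, applied to \<open>f\<close> itself, shows that these maps form the closure of
  those of kernel rank exactly \<open>s - r\<close> (\<open>Sigma_bar_at_eq\<close>).
\<close>

section \<open>Kernels and ranks of matrices over a field\<close>

lemma matrix_of_linear:
  fixes g :: "'a::field ^ 'n \<Rightarrow> 'a ^ 'm"
  assumes "Vector_Spaces.linear (*s) (*s) g"
  obtains A where "\<And>x. A *v x = g x"
  using matrix_works[OF assms] by blast

lemma subspace_ker: "vec.subspace (ker M)"
  by (simp add: vec.subspace_def ker_def matrix_vector_right_distrib vector_scalar_commute)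

text \<open>
  A generalized inverse of \<open>T\<close> restricted to \<open>V\<close>: it picks linearly one preimage in \<open>V\<close> of each vector
  in the image of \<open>V\<close>. Complements, projections and rank-nullity all come from it, without bases.
\<close>

lemma exists_relative_inverse:
  fixes T :: "'a::field ^ 'n ^ 'm"
  assumes "vec.subspace V"
  obtains G where "\<And>y. G *v y \<in> V" "\<And>x. x \<in> V \<Longrightarrow> T *v (G *v (T *v x)) = T *v x"
proof -
  obtain g where g: "g ` UNIV \<subseteq> V" "Vector_Spaces.linear (*s) (*s) g"
     "\<forall>v\<in>(*v) T ` V. T *v (g v) = v"
    using vec.linear_exists_right_inverse_on[OF matrix_vector_mul_linear_gen assms] by blast
  obtain G where "\<And>x. G *v x = g x" using matrix_of_linear[OF g(2)] by blast
  then show ?thesis using g that by (metis UNIV_I image_eqI image_subset_iff)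
qed

lemma exists_projection:
  fixes S :: "('a::field ^ 'n) set"
  assumes "vec.subspace S"
  obtains P where "\<And>x. P *v x \<in> S" "\<And>x. x \<in> S \<Longrightarrow> P *v x = x"
  using exists_relative_inverse[OF assms, of "mat 1"] by auto

lemma rank_nullity:
  fixes T :: "'a::field ^ 'n ^ 'm"
  assumes V: "vec.subspace V"
  shows "vec.dim {x \<in> V. T *v x = 0} + vec.dim ((*v) T ` V) = vec.dim V"
proof -
  obtain G where G: "\<And>y. G *v y \<in> V" "\<And>x. x \<in> V \<Longrightarrow> T *v (G *v (T *v x)) = T *v x"
    using exists_relative_inverse[OF V] by blast
  let ?K = "{x \<in> V. T *v x = 0}" and ?R = "(*v) T ` V"
  \<comment> \<open>The section \<open>G\<close> maps the image injectively onto a complement of the kernel in \<open>V\<close>.\<close>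
  let ?C = "(*v) G ` ?R"
  have K: "vec.subspace ?K"
    using V by (auto simp: vec.subspace_def matrix_vector_right_distrib vector_scalar_commute)
  have R: "vec.subspace ?R" using V by (simp add: vec.subspace_image)
  have C: "vec.subspace ?C" using R by (simp add: vec.subspace_image)
  have inj: "inj_on ((*v) G) ?R" using G(2) by (intro inj_on_inverseI[where g="(*v) T"]) auto
  have "vec.dim ?C = vec.dim ?R"
    using vec.dim_image_eq[OF matrix_vector_mul_linear_gen, of G ?R] inj R
    by (metis vec.span_eq_iff)
  moreover have "?K \<inter> ?C = {0}"
  proof -
    have "v = 0" if v: "v \<in> ?K" "v \<in> ?C" for v
    proof -
      obtain x where "x \<in> V" "v = G *v (T *v x)" using v by blast
      then show ?thesis using v G(2) by auto
    qed
    then show ?thesis using vec.subspace_0[OF K] vec.subspace_0[OF C] by blast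
  qed
  moreover have "{x + y |x y. x \<in> ?K \<and> y \<in> ?C} = V"
  proof (intro equalityI subsetI)
    fix v assume v: "v \<in> V"
    have "v - G *v (T *v v) \<in> ?K"
      using v G V by (simp add: vec.subspace_diff matrix_vector_mult_diff_distrib)
    moreover have "G *v (T *v v) \<in> ?C" using v by blast
    ultimately show "v \<in> {x + y |x y. x \<in> ?K \<and> y \<in> ?C}"
      by (intro CollectI exI[of _ "v - G *v (T *v v)"] exI[of _ "G *v (T *v v)"]) simp
  qed (use G V in \<open>auto simp: vec.subspace_add\<close>)
  ultimately show ?thesis using vec.dim_sums_Int[OF K C] by simp
qed

lemma dim_ker:
  fixes A :: "complex ^ 'n ^ 'm"
  shows "vec.dim (ker A) + vec.dim (range ((*v) A)) = CARD('n)"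
  using rank_nullity[OF vec.subspace_UNIV, of A] vec_dim_card by (simp add: ker_def del: vec.dim_UNIV)

text \<open>
  A basis of the column space of \<open>A\<close>, with \<open>d\<close> members, factors \<open>A\<close> into a product with \<open>d\<close> rows in the
  second factor, and these \<open>d\<close> vectors \<open>c b\<close> then span the row space.
\<close>

lemma dim_range_transpose_le:
  fixes A :: "'a::field ^ 'n ^ 'm"
  shows "vec.dim (range ((*v) (transpose A))) \<le> vec.dim (range ((*v) A))"
proof -
  have "vec.subspace (range ((*v) A))" by (simp add: vec.subspace_image)
  then obtain B where B: "finite B" "vec.independent B" "vec.span B = range ((*v) A)"
      "card B = vec.dim (range ((*v) A))"
    using vec.basis_subspace_exists by metis
  define c where "c b = (\<chi> j. vec.representation B (A *v axis j 1) b)" for b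
  have A: "A $ i $ j = (\<Sum>b\<in>B. c b $ j * b $ i)" for i j
  proof -
    have "A *v axis j 1 \<in> vec.span B" using B by blast
    then have "(\<Sum>b\<in>B. c b $ j *s b) = A *v axis j 1"
      using vec.sum_representation_eq[OF B(2) _ B(1) order_refl] by (simp add: c_def)
    then have "(\<Sum>b\<in>B. c b $ j *s b) $ i = (A *v axis j 1) $ i" by simp
    then show ?thesis by (simp add: matrix_vector_mult_def axis_def if_distrib[where f="\<lambda>x. _ * x"] cong: if_cong)
  qed
  have "transpose A *v y = (\<Sum>b\<in>B. (\<Sum>i\<in>UNIV. b $ i * y $ i) *s c b)" for y
  proof -
    have "(\<Sum>i\<in>UNIV. (\<Sum>b\<in>B. c b $ j * b $ i) * y $ i) = (\<Sum>b\<in>B. (\<Sum>i\<in>UNIV. b $ i * y $ i) * c b $ j)"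
      for j
      unfolding sum_distrib_right by (subst sum.swap) (simp add: mult_ac)
    then show ?thesis by (simp add: vec_eq_iff matrix_vector_mult_def transpose_def A)
  qed
  then have "range ((*v) (transpose A)) \<subseteq> vec.span (c ` B)"
    by (auto intro!: vec.span_sum vec.span_scale intro: vec.span_base)
  then have "vec.dim (range ((*v) (transpose A))) \<le> card (c ` B)"
    using B(1) by (intro vec.dim_le_card) auto
  then show ?thesis using card_image_le[OF B(1), of c] B(4) by linarith
qed

lemma dim_range_transpose:
  fixes A :: "'a::field ^ 'n ^ 'm"
  shows "vec.dim (range ((*v) (transpose A))) = vec.dim (range ((*v) A))"
  using dim_range_transpose_le[of A] dim_range_transpose_le[of "transpose A"] by simp

lemma exists_subspace_between:
  fixes R K :: "('a::field ^ 'n) set"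
  assumes "vec.subspace R" "vec.subspace K" "R \<subseteq> K" "vec.dim R \<le> d" "d \<le> vec.dim K"
  obtains S where "vec.subspace S" "R \<subseteq> S" "S \<subseteq> K" "vec.dim S = d"
proof -
  obtain B where B: "B \<subseteq> R" "vec.independent B" "vec.span B = R" "card B = vec.dim R"
    using vec.basis_subspace_exists[OF assms(1)] by metis
  obtain C where C: "B \<subseteq> C" "C \<subseteq> K" "vec.independent C" "K \<subseteq> vec.span C"
    using vec.maximal_independent_subset_extend[of B K] B assms(3) by blast
  have "card C = vec.dim K" using C vec.basis_card_eq_dim by blast
  then obtain D where D: "B \<subseteq> D" "D \<subseteq> C" "card D = d"
    using exists_subset_between[of B d C] B C assms vec.finiteI_independent by metis
  show ?thesis
  proof
    show "R \<subseteq> vec.span D" using B D vec.span_mono by blast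
    show "vec.span D \<subseteq> K" using D C assms vec.span_minimal by (metis subset_trans)
    show "vec.dim (vec.span D) = d"
      using D C vec.independent_mono vec.dim_span_eq_card_independent by metis
  qed simp
qed

text \<open>
  Write \<open>K\<close> for the kernel of \<open>T\<close> on \<open>V\<close> and \<open>R\<close> for its image. The direction \<open>N\<close> is built from a
  projection of \<open>V\<close> onto \<open>K\<close>, followed by a map on \<open>K\<close> that kills exactly \<open>S\<close>, followed by an injection
  into a complement \<open>D\<close> of \<open>R\<close> in \<open>W\<close>; the hypothesis on dimensions makes room for the injection.
  Since \<open>R\<close> and \<open>D\<close> meet in zero, \<open>T x + t N x = 0\<close> forces \<open>T x\<close> and \<open>N x\<close> to vanish separately. This is
  why the kernel is \<open>S\<close> for every nonzero \<open>t\<close> and not only for generic \<open>t\<close>.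
\<close>

lemma exists_kernel_perturbation:
  fixes T :: "'a::field ^ 'n ^ 'm"
  assumes V: "vec.subspace V" and W: "vec.subspace W" and TW: "\<And>x. x \<in> V \<Longrightarrow> T *v x \<in> W"
    and S: "vec.subspace S" "S \<subseteq> V" "\<And>x. x \<in> S \<Longrightarrow> T *v x = 0"
    and dim: "vec.dim V \<le> vec.dim S + vec.dim W"
  shows "\<exists>N. (\<forall>x\<in>V. N *v x \<in> W) \<and> (\<forall>t. t \<noteq> 0 \<longrightarrow> {x \<in> V. T *v x + t *s (N *v x) = 0} = S)"
proof -
  let ?K = "{x \<in> V. T *v x = 0}" and ?R = "(*v) T ` V"
  have K: "vec.subspace ?K"
    using V by (auto simp: vec.subspace_def matrix_vector_right_distrib vector_scalar_commute)
  have R: "vec.subspace ?R" using V by (simp add: vec.subspace_image)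
  obtain G where G: "\<And>y. G *v y \<in> V" "\<And>x. x \<in> V \<Longrightarrow> T *v (G *v (T *v x)) = T *v x"
    using exists_relative_inverse[OF V] by blast
  obtain P where P: "\<And>x. P *v x \<in> S" "\<And>x. x \<in> S \<Longrightarrow> P *v x = x"
    using exists_projection[OF S(1)] by blast
  obtain Q where Q: "\<And>x. Q *v x \<in> ?R" "\<And>x. x \<in> ?R \<Longrightarrow> Q *v x = x"
    using exists_projection[OF R] by blast
  define P' where "P' = mat 1 - P"
  define Q' where "Q' = mat 1 - Q"
  have P': "P' *v x = x - P *v x" for x
    by (simp add: P'_def matrix_vector_mult_diff_rdistrib)
  have Q': "Q' *v x = x - Q *v x" for x
    by (simp add: Q'_def matrix_vector_mult_diff_rdistrib)
  have P0: "P' *v x = 0 \<longleftrightarrow> x \<in> S" for x using P[of x] P' by (metis right_minus_eq)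
  have Q0: "Q' *v x = 0 \<longleftrightarrow> x \<in> ?R" for x using Q[of x] Q' by (metis right_minus_eq)
  \<comment> \<open>\<open>?E\<close> is a model of \<open>?K\<close> modulo \<open>S\<close>, and \<open>?D\<close> is a complement of \<open>?R\<close> in \<open>W\<close>.\<close>
  let ?E = "(*v) P' ` ?K" and ?D = "(*v) Q' ` W"
  have "{x \<in> ?K. P' *v x = 0} = S" using S P0 by auto
  then have dE: "vec.dim S + vec.dim ?E = vec.dim ?K" using rank_nullity[OF K, of P'] by (simp only:)
  have "{x \<in> W. Q' *v x = 0} = ?R" using TW Q0 by auto
  then have dD: "vec.dim ?R + vec.dim ?D = vec.dim W" using rank_nullity[OF W, of Q'] by (simp only:)
  have dED: "vec.dim ?E \<le> vec.dim ?D" using dE dD dim rank_nullity[OF V, of T] by linarith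
  have E: "vec.subspace ?E" by (rule vec.subspace_image[OF K])
  have D: "vec.subspace ?D" by (rule vec.subspace_image[OF W])
  have span_D: "vec.span ?D = ?D" using D by (simp only: vec.span_eq_iff)
  obtain D' where D': "vec.subspace D'" "D' \<subseteq> ?D" "vec.dim D' = vec.dim ?E"
    using vec.choose_subspace_of_subspace[OF dED] unfolding span_D by blast
  obtain g where g: "Vector_Spaces.linear (*s) (*s) g" "g ` ?E = D'" "inj_on g ?E"
    using vec.subspace_isomorphism[OF E D'(1) D'(3)[symmetric]] by blast
  obtain J where J: "\<And>x. J *v x = g x" using matrix_of_linear[OF g(1)] by blast
  have J0: "x = 0" if "x \<in> ?E" "J *v x = 0" for x
  proof (rule inj_onD[OF g(3)])
    show "g x = g 0" using that(2) J[of x] J[of 0] by simp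
  qed (use that(1) vec.subspace_0[OF E] in auto)
  define N where "N = J ** (P' ** (mat 1 - G ** T))"
  have N: "N *v x = J *v (P' *v (x - G *v (T *v x)))" for x
    by (simp add: N_def matrix_vector_mul_assoc[symmetric] matrix_vector_mult_diff_rdistrib)
  have inK: "x - G *v (T *v x) \<in> ?K" if "x \<in> V" for x
    using that G V by (simp add: vec.subspace_diff matrix_vector_mult_diff_distrib)
  have ND: "N *v x \<in> ?D" if "x \<in> V" for x
    using inK[OF that] g(2) D'(2) unfolding N J by blast
  have DW: "?D \<subseteq> W"
  proof safe
    fix y assume y: "y \<in> W"
    have "Q *v y \<in> W" using Q(1)[of y] TW by auto
    then show "Q' *v y \<in> W" using y W by (simp add: Q' vec.subspace_diff)
  qed
  have DR: "y = 0" if y: "y \<in> ?D" "y \<in> ?R" for y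
  proof -
    obtain w where w: "y = Q' *v w" using y by blast
    have "y + Q *v w \<in> ?R" using vec.subspace_add[OF R y(2) Q(1)] .
    then have "w \<in> ?R" by (simp add: w Q')
    then show ?thesis using w Q0 by simp
  qed
  show ?thesis
  proof (intro exI[of _ N] conjI ballI allI impI)
    show "N *v x \<in> W" if "x \<in> V" for x using ND[OF that] DW by blast
  next
    fix t :: 'a assume t: "t \<noteq> 0"
    show "{x \<in> V. T *v x + t *s (N *v x) = 0} = S"
    proof (intro equalityI subsetI)
      fix x assume "x \<in> {x \<in> V. T *v x + t *s (N *v x) = 0}"
      then have x: "x \<in> V" and eq: "T *v x + t *s (N *v x) = 0" by auto
      have "t *s (N *v x) \<in> ?D" using vec.subspace_scale[OF D ND[OF x]] .
      moreover have "t *s (N *v x) = - (T *v x)" using eq by (simp add: add_eq_0_iff)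
      moreover have "- (T *v x) \<in> ?R" using vec.subspace_neg[OF R] x by blast
      ultimately have tN: "t *s (N *v x) = 0" using DR[of "t *s (N *v x)"] by simp
      then have Nx: "N *v x = 0" using t by simp
      have Tx: "T *v x = 0" using eq tN by simp
      have "P' *v x \<in> ?E" using x Tx by blast
      then have "P' *v x = 0" using J0 Nx Tx by (simp add: N)
      then show "x \<in> S" using P0 by blast
    next
      fix x assume x: "x \<in> S"
      then have "P' *v x = 0" using P0 by blast
      then have "N *v x = 0" using S(3)[OF x] by (simp add: N)
      then show "x \<in> {x \<in> V. T *v x + t *s (N *v x) = 0}" using x S by auto
    qed
  qed
qed

section \<open>Holomorphic matrix-valued functions\<close>

text \<open>
  The derivative is the real one, and its compatibility with complex scalars is the Cauchy-Riemann
  condition.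
\<close>

definition holo :: "(complex ^ 'n ^ 'm \<Rightarrow> complex) \<Rightarrow> complex ^ 'n ^ 'm \<Rightarrow> bool" where
  "holo f A \<longleftrightarrow> (\<exists>f'. (f has_derivative f') (at A) \<and> (\<forall>c B. f' (cscale c B) = c * f' B))"

lemma holo_const: "holo (\<lambda>A. c) A"
  unfolding holo_def by (rule exI[of _ "\<lambda>_. 0"]) simp

lemma holo_entry: "holo (\<lambda>A. A $ i $ j) A"
  unfolding holo_def
  by (rule exI[of _ "\<lambda>A. A $ i $ j"])
    (auto intro!: bounded_linear.has_derivative[OF bounded_linear_vec_nth] simp: cscale_def)

lemma holo_add:
  assumes "holo f A" "holo g A" shows "holo (\<lambda>A. f A + g A) A"
proof -
  obtain f' g' where d: "(f has_derivative f') (at A)" "\<And>c B. f' (cscale c B) = c * f' B"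
    "(g has_derivative g') (at A)" "\<And>c B. g' (cscale c B) = c * g' B"
    using assms unfolding holo_def by blast
  show ?thesis unfolding holo_def
    by (intro exI conjI, rule has_derivative_add[OF d(1) d(3)]) (simp add: d algebra_simps)
qed

lemma holo_mult:
  assumes "holo f A" "holo g A" shows "holo (\<lambda>A. f A * g A) A"
proof -
  obtain f' g' where d: "(f has_derivative f') (at A)" "\<And>c B. f' (cscale c B) = c * f' B"
    "(g has_derivative g') (at A)" "\<And>c B. g' (cscale c B) = c * g' B"
    using assms unfolding holo_def by blast
  show ?thesis unfolding holo_def
    by (intro exI conjI, rule has_derivative_mult[OF d(1) d(3)]) (simp add: d algebra_simps)
qed

lemma holo_inverse:
  assumes "holo f A" "f A \<noteq> 0" shows "holo (\<lambda>A. inverse (f A)) A"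
proof -
  obtain f' where d: "(f has_derivative f') (at A)" "\<And>c B. f' (cscale c B) = c * f' B"
    using assms unfolding holo_def by blast
  show ?thesis unfolding holo_def
    by (intro exI conjI, rule Deriv.has_derivative_inverse[OF assms(2) d(1)]) (simp add: d algebra_simps)
qed

lemma holo_sum: "(\<And>i. i \<in> I \<Longrightarrow> holo (f i) A) \<Longrightarrow> holo (\<lambda>A. \<Sum>i\<in>I. f i A) A"
  by (induction I rule: infinite_finite_induct) (auto intro: holo_const holo_add)

lemma holo_prod: "(\<And>i. i \<in> I \<Longrightarrow> holo (f i) A) \<Longrightarrow> holo (\<lambda>A. \<Prod>i\<in>I. f i A) A"
  by (induction I rule: infinite_finite_induct) (auto intro: holo_const holo_mult)

definition holo_mat :: "(complex ^ 'n ^ 'm \<Rightarrow> complex ^ 'p ^ 'q) \<Rightarrow> complex ^ 'n ^ 'm \<Rightarrow> bool" where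
  "holo_mat f A \<longleftrightarrow> (\<forall>i j. holo (\<lambda>A. f A $ i $ j) A)"

lemma has_derivative_matrix:
  fixes f :: "'a::real_normed_vector \<Rightarrow> complex ^ 'p ^ 'q"
  assumes "\<And>i j. ((\<lambda>x. f x $ i $ j) has_derivative (\<lambda>h. f' h $ i $ j)) (at x within S)"
  shows "(f has_derivative f') (at x within S)"
proof (subst has_derivative_componentwise_within, rule ballI)
  fix b :: "complex ^ 'p ^ 'q" assume "b \<in> Basis"
  then obtain i j c where b: "b = axis i (axis j c)" by (auto simp: Basis_vec_def)
  show "((\<lambda>x. f x \<bullet> b) has_derivative (\<lambda>x. f' x \<bullet> b)) (at x within S)"
    using bounded_linear.has_derivative[OF bounded_linear_inner_left[of c] assms[of i j]]
    by (simp add: b inner_axis)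
qed

lemma holo_mat_derivative:
  assumes "holo_mat f A"
  obtains f' where "(f has_derivative f') (at A)" "\<And>c B. f' (cscale c B) = cscale c (f' B)"
proof -
  obtain F where F: "\<And>i j. ((\<lambda>A. f A $ i $ j) has_derivative F i j) (at A)"
    "\<And>i j c B. F i j (cscale c B) = c * F i j B"
    using assms unfolding holo_mat_def holo_def by metis
  show ?thesis
  proof (rule that[of "\<lambda>B. \<chi> i j. F i j B"])
    show "(f has_derivative (\<lambda>B. \<chi> i j. F i j B)) (at A)"
      by (rule has_derivative_matrix) (simp add: F(1))
  qed (simp add: F(2), simp add: cscale_def)
qed

lemma holomorphic_mat_on_holo_mat: "(\<And>A. A \<in> U \<Longrightarrow> holo_mat f A) \<Longrightarrow> holomorphic_mat_on f U"
  unfolding holomorphic_mat_on_def using holo_mat_derivative by metis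

lemma holo_mat_continuous: "holo_mat f A \<Longrightarrow> isCont f A"
  using holo_mat_derivative has_derivative_continuous by metis

lemma holo_mat_const: "holo_mat (\<lambda>A. C) A"
  by (simp add: holo_mat_def holo_const)

lemma holo_mat_ident: "holo_mat (\<lambda>A. A) A"
  by (simp add: holo_mat_def holo_entry)

lemma holo_mat_add: "holo_mat f A \<Longrightarrow> holo_mat g A \<Longrightarrow> holo_mat (\<lambda>A. f A + g A) A"
  by (simp add: holo_mat_def holo_add)

lemma holo_mat_diff:
  assumes "holo_mat f A" "holo_mat g A" shows "holo_mat (\<lambda>A. f A - g A) A"
proof -
  have "holo (\<lambda>A. f A $ i $ j + (- 1) * g A $ i $ j) A" for i j
    using assms unfolding holo_mat_def by (intro holo_add holo_mult holo_const) auto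
  then show ?thesis by (simp add: holo_mat_def)
qed

lemma holo_mat_mult: "holo_mat f A \<Longrightarrow> holo_mat g A \<Longrightarrow> holo_mat (\<lambda>A. f A ** g A) A"
  by (simp add: holo_mat_def matrix_matrix_mult_def holo_sum holo_mult)

lemma holo_det:
  assumes "holo_mat f A" shows "holo (\<lambda>A. det (f A)) A"
  unfolding det_def using assms unfolding holo_mat_def
  by (intro holo_sum holo_mult holo_const holo_prod) auto

text \<open>
  By Cramer's rule the inverse is a rational function of the entries, which makes it holomorphic.
\<close>

definition cramer_inverse :: "'a::field ^ 'n ^ 'n \<Rightarrow> 'a ^ 'n ^ 'n" where
  "cramer_inverse H =
     (\<chi> k l. det (\<chi> i j. if j = k then axis l 1 $ i else H $ i $ j) * inverse (det H))"

lemma cramer_inverse_right: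
  assumes "det H \<noteq> 0" shows "H ** cramer_inverse H = mat 1"
proof -
  have "H *v column l (cramer_inverse H) = axis l 1" for l
    by (subst cramer[OF assms]) (simp add: cramer_inverse_def column_def divide_inverse)
  then show ?thesis
    by (auto simp: vec_eq_iff matrix_matrix_mult_def matrix_vector_mult_def column_def mat_def axis_def)
qed

lemma cramer_inverse_left:
  assumes "det H \<noteq> 0" shows "cramer_inverse H ** H = mat 1"
  using cramer_inverse_right[OF assms] matrix_left_right_inverse by metis

lemma holo_mat_cramer_inverse:
  assumes "holo_mat f A" "det (f A) \<noteq> 0" shows "holo_mat (\<lambda>A. cramer_inverse (f A)) A"
proof -
  have *: "holo_mat (\<lambda>A. \<chi> i j. if j = k then axis l 1 $ i else f A $ i $ j) A" for k l
    unfolding holo_mat_def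
  proof (intro allI)
    fix i j
    show "holo (\<lambda>A. (\<chi> i j. if j = k then axis l 1 $ i else f A $ i $ j) $ i $ j) A"
      using assms(1) by (cases "j = k") (simp_all add: holo_const holo_mat_def)
  qed
  show ?thesis
    unfolding holo_mat_def cramer_inverse_def vec_lambda_beta
    by (intro allI holo_mult holo_det * holo_inverse assms)
qed

lemma tendsto_matrix_mult:
  fixes f :: "'a \<Rightarrow> complex ^ 'n ^ 'm" and g :: "'a \<Rightarrow> complex ^ 'p ^ 'n"
  assumes "(f \<longlongrightarrow> A) F" "(g \<longlongrightarrow> B) F"
  shows "((\<lambda>x. f x ** g x) \<longlongrightarrow> A ** B) F"
  unfolding matrix_matrix_mult_def
  by (intro vec_tendstoI) (auto intro!: tendsto_sum tendsto_mult tendsto_vec_nth assms)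

section \<open>The Schur complement chart\<close>

lemma matrix_diff_ldistrib: "A ** (B - C) = A ** B - A ** (C :: 'a::ring_1 ^ 'p ^ 'n)"
  by (simp add: matrix_matrix_mult_def vec_eq_iff right_diff_distrib sum_subtractf)

lemma matrix_diff_rdistrib: "(A - B) ** C = A ** C - B ** (C :: 'a::ring_1 ^ 'p ^ 'n)"
  by (simp add: matrix_matrix_mult_def vec_eq_iff left_diff_distrib sum_subtractf)

lemma matrix_mult_zero [simp]: "A ** (0 :: 'a::semiring_1 ^ 'n ^ 'm) = 0"
  by (simp add: matrix_matrix_mult_def vec_eq_iff)

lemma matrix_add_rdistrib': "(A + B) ** C = A ** C + B ** (C :: 'a::semiring_1 ^ 'p ^ 'n)"
  by (simp add: matrix_matrix_mult_def vec_eq_iff distrib_right sum.distrib)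

lemmas matrix_distribs = matrix_diff_ldistrib matrix_diff_rdistrib matrix_add_ldistrib matrix_add_rdistrib'

lemma scaleR_matrix_mult:
  fixes A :: "complex ^ 'n ^ 'm" and B :: "complex ^ 'p ^ 'n"
  shows "(t *\<^sub>R A) ** B = t *\<^sub>R (A ** B)" "A ** (t *\<^sub>R B) = t *\<^sub>R (A ** B)"
  by (simp_all add: vec_eq_iff matrix_matrix_mult_def scaleR_sum_right)

text \<open>
  The matrix \<open>ginv x\<close> is a reflexive generalized inverse of \<open>x\<close>, called \<open>G\<close> in the following picture.
  It splits the source into the image of \<open>G\<close> and the kernel of \<open>x\<close>, and the target into the image of
  \<open>x\<close> and the kernel of \<open>G\<close>, and \<open>x\<close> and \<open>G\<close> are mutually inverse between the first summands. With
  these identified, a matrix \<open>A\<close> has blocks \<open>a\<close>, \<open>b\<close> (upper row) and \<open>c\<close>, \<open>d\<close> (lower row), and \<open>x\<close>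
  has \<open>a = 1\<close> and the other blocks zero. The constants below are written without choosing bases:

  \<^item> \<open>ker_proj x\<close> and \<open>coker_proj x\<close> project onto the second summands;
  \<^item> \<open>pivot x A\<close> has upper row \<open>a\<close>, \<open>b\<close> and lower row \<open>0\<close>, \<open>1\<close>, so that it is invertible exactly if
    \<open>a\<close> is, and its inverse has the block \<open>- a\<^sup>-\<^sup>1 b\<close> in the upper right corner;
  \<^item> \<open>corner x A\<close> is \<open>- c a\<^sup>-\<^sup>1 b\<close>, placed in the lower right corner.

  The chart is \<open>A \<mapsto> A + corner x A\<close>. It replaces \<open>d\<close> by the Schur complement \<open>d - c a\<^sup>-\<^sup>1 b\<close> and leaves
  the other blocks alone.
\<close>

definition ginv :: "complex ^ 'n ^ 'm \<Rightarrow> complex ^ 'm ^ 'n" where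
  "ginv x = (SOME G. x ** G ** x = x \<and> G ** x ** G = G)"

definition ker_proj :: "complex ^ 'n ^ 'm \<Rightarrow> complex ^ 'n ^ 'n" where
  "ker_proj x = mat 1 - ginv x ** x"

definition coker_proj :: "complex ^ 'n ^ 'm \<Rightarrow> complex ^ 'm ^ 'm" where
  "coker_proj x = mat 1 - x ** ginv x"

definition pivot :: "complex ^ 'n ^ 'm \<Rightarrow> complex ^ 'n ^ 'm \<Rightarrow> complex ^ 'n ^ 'n" where
  "pivot x A = mat 1 + ginv x ** (A - x)"

abbreviation pivot_inv :: "complex ^ 'n ^ 'm \<Rightarrow> complex ^ 'n ^ 'm \<Rightarrow> complex ^ 'n ^ 'n" where
  "pivot_inv x A \<equiv> cramer_inverse (pivot x A)"

definition chart_domain :: "complex ^ 'n ^ 'm \<Rightarrow> (complex ^ 'n ^ 'm) set" where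
  "chart_domain x = {A. det (pivot x A) \<noteq> 0}"

definition corner :: "complex ^ 'n ^ 'm \<Rightarrow> complex ^ 'n ^ 'm \<Rightarrow> complex ^ 'n ^ 'm" where
  "corner x A = coker_proj x ** A ** (mat 1 - ker_proj x) ** pivot_inv x A ** ker_proj x"

lemma mult_ginv_mult: "x ** ginv x ** x = x"
  and ginv_mult_ginv: "ginv x ** x ** ginv x = ginv x"
  for x :: "complex ^ 'n ^ 'm"
proof -
  obtain G where "\<And>z. x *v (G *v (x *v z)) = x *v z"
    using exists_relative_inverse[OF vec.subspace_UNIV, of x] by (metis UNIV_I)
  then have 1: "x ** (G ** x) = x" by (simp add: matrix_eq matrix_vector_mul_assoc matrix_mul_assoc)
  then have 2: "x ** (G ** (x ** Y)) = x ** Y" for Y :: "complex ^ 'm ^ 'n"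
    by (simp add: matrix_mul_assoc)
  \<comment> \<open>Any generalized inverse \<open>G\<close> of \<open>x\<close> becomes reflexive when replaced by \<open>G x G\<close>.\<close>
  let ?G = "G ** x ** G"
  have "x ** ?G ** x = x \<and> ?G ** x ** ?G = ?G" by (simp add: matrix_mul_assoc[symmetric] 1 2)
  then have "x ** ginv x ** x = x \<and> ginv x ** x ** ginv x = ginv x" unfolding ginv_def by (rule someI)
  then show "x ** ginv x ** x = x" "ginv x ** x ** ginv x = ginv x" by simp_all
qed

lemma x_ker_proj: "x ** ker_proj x = 0"
  and ker_proj_idem: "ker_proj x ** ker_proj x = ker_proj x"
  and ginv_coker_proj: "ginv x ** coker_proj x = 0"
  and ker_proj_ginv: "ker_proj x ** ginv x = 0"
  by (simp_all add: ker_proj_def coker_proj_def matrix_distribs matrix_mul_assoc mult_ginv_mult ginv_mult_ginv)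

lemma mem_ker_iff: "z \<in> ker x \<longleftrightarrow> ker_proj x *v z = z"
proof -
  have "x *v z = x *v (ginv x *v (x *v z))"
    by (simp add: matrix_vector_mul_assoc mult_ginv_mult matrix_mul_assoc)
  then show ?thesis by (auto simp: ker_def ker_proj_def matrix_vector_mult_diff_rdistrib
      matrix_vector_mul_assoc[symmetric])
qed

lemma holo_pivot: "holo_mat (pivot x) A"
  unfolding pivot_def by (intro holo_mat_add holo_mat_mult holo_mat_diff holo_mat_const holo_mat_ident)

lemma holo_pivot_inv: "A \<in> chart_domain x \<Longrightarrow> holo_mat (pivot_inv x) A"
  by (rule holo_mat_cramer_inverse[OF holo_pivot]) (simp add: chart_domain_def)

lemma pivot_x: "pivot x x = mat 1" by (simp add: pivot_def)

lemma x_in_domain: "x \<in> chart_domain x" by (simp add: chart_domain_def pivot_x)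

lemma pivot_inv_x: "pivot_inv x x = mat 1"
  using cramer_inverse_right[of "pivot x x"] by (simp add: pivot_x)

lemma open_domain: "open (chart_domain x)"
proof -
  have "isCont (\<lambda>A. det (pivot x A)) A" for A
    using holo_det[OF holo_pivot] has_derivative_continuous unfolding holo_def by blast
  then have "open ((\<lambda>A. det (pivot x A)) -` (- {0}))"
    by (intro continuous_open_vimage) (auto simp: continuous_on_eq_continuous_at)
  then show ?thesis by (simp add: chart_domain_def vimage_def)
qed

lemma pivot_mult_inv: "A \<in> chart_domain x \<Longrightarrow> pivot x A ** pivot_inv x A = mat 1"
  and inv_mult_pivot: "A \<in> chart_domain x \<Longrightarrow> pivot_inv x A ** pivot x A = mat 1"
  by (simp_all add: chart_domain_def cramer_inverse_right cramer_inverse_left)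

lemma ker_proj_pivot_inv:
  assumes "A \<in> chart_domain x" shows "ker_proj x ** pivot_inv x A = ker_proj x"
proof -
  have "ker_proj x ** pivot x A = ker_proj x" by (simp add: pivot_def matrix_distribs matrix_mul_assoc ker_proj_ginv)
  then have "ker_proj x ** pivot_inv x A = ker_proj x ** (pivot x A ** pivot_inv x A)" by (simp add: matrix_mul_assoc)
  then show ?thesis using pivot_mult_inv[OF assms] by simp
qed

text \<open>
  Multiplication by the inverse pivot is column elimination: it turns the upper row of \<open>A\<close> into \<open>1\<close>, \<open>0\<close>.
\<close>

lemma ginv_mult_pivot_inv:
  assumes "A \<in> chart_domain x" shows "ginv x ** A ** pivot_inv x A = mat 1 - ker_proj x"
proof -
  have "ginv x ** A = pivot x A - ker_proj x" by (simp add: pivot_def ker_proj_def matrix_distribs)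
  then show ?thesis using pivot_mult_inv[OF assms] ker_proj_pivot_inv[OF assms] by (simp add: matrix_distribs)
qed

lemma ker_mult_pivot_inv:
  assumes "A \<in> chart_domain x" shows "ker (A ** pivot_inv x A) \<subseteq> ker x"
proof
  fix z assume "z \<in> ker (A ** pivot_inv x A)"
  then have "ginv x *v ((A ** pivot_inv x A) *v z) = 0" by (simp add: ker_def)
  then have "(mat 1 - ker_proj x) *v z = 0"
    using ginv_mult_pivot_inv[OF assms] by (simp add: matrix_vector_mul_assoc matrix_mul_assoc)
  then show "z \<in> ker x" by (simp add: mem_ker_iff matrix_vector_mult_diff_rdistrib)
qed

lemma dim_ker_mult_pivot_inv:
  assumes "A \<in> chart_domain x" shows "vec.dim (ker (A ** pivot_inv x A)) = vec.dim (ker A)"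
proof -
  have inverse: "pivot x A *v (pivot_inv x A *v z) = z" "pivot_inv x A *v (pivot x A *v z) = z" for z
    using pivot_mult_inv[OF assms] inv_mult_pivot[OF assms] by (simp_all add: matrix_vector_mul_assoc)
  have "ker A = (*v) (pivot_inv x A) ` ker (A ** pivot_inv x A)"
    using inverse(2) by (auto simp: ker_def matrix_vector_mul_assoc[symmetric] image_iff) metis
  moreover have "inj_on ((*v) (pivot_inv x A)) S" for S by (rule inj_on_inverseI) (rule inverse(1))
  ultimately show ?thesis using vec.dim_image_eq[OF matrix_vector_mul_linear_gen] by metis
qed

lemma dim_ker_le: "A \<in> chart_domain x \<Longrightarrow> vec.dim (ker A) \<le> vec.dim (ker x)"
  using dim_ker_mult_pivot_inv vec.dim_subset[OF ker_mult_pivot_inv] by metis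

text \<open>
  After the column elimination the kernel lies in the kernel of \<open>x\<close>, so it has the same dimension only
  if it is all of it, and the only block that acts on the kernel of \<open>x\<close> is the Schur complement. The
  product on the right is that block.
\<close>

lemma dim_ker_ge_iff:
  assumes A: "A \<in> chart_domain x"
  shows "vec.dim (ker x) \<le> vec.dim (ker A) \<longleftrightarrow> A ** pivot_inv x A ** ker_proj x = 0"
proof
  assume "vec.dim (ker x) \<le> vec.dim (ker A)"
  then have eq: "ker (A ** pivot_inv x A) = ker x"
    using vec.subspace_dim_equal[OF subspace_ker subspace_ker ker_mult_pivot_inv[OF A]]
      dim_ker_mult_pivot_inv[OF A]
    by simp
  have "ker_proj x *v z \<in> ker x" for z
    by (simp add: mem_ker_iff matrix_vector_mul_assoc ker_proj_idem)
  then have "(A ** pivot_inv x A) *v (ker_proj x *v z) = 0" for z using eq by (auto simp: ker_def)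
  then show "A ** pivot_inv x A ** ker_proj x = 0" by (simp add: matrix_eq matrix_vector_mul_assoc)
next
  assume *: "A ** pivot_inv x A ** ker_proj x = 0"
  have "ker x \<subseteq> ker (A ** pivot_inv x A)"
  proof
    fix z assume "z \<in> ker x"
    then have "z = ker_proj x *v z" using mem_ker_iff[of z x] by simp
    then have "(A ** pivot_inv x A) *v z = (A ** pivot_inv x A ** ker_proj x) *v z" by (metis matrix_vector_mul_assoc)
    then show "z \<in> ker (A ** pivot_inv x A)" using * by (simp add: ker_def)
  qed
  then show "vec.dim (ker x) \<le> vec.dim (ker A)" using vec.dim_subset dim_ker_mult_pivot_inv[OF A] by metis
qed

lemma coker_proj_mult:
  assumes A: "A \<in> chart_domain x"
  shows "coker_proj x ** A ** pivot_inv x A ** ker_proj x = A ** pivot_inv x A ** ker_proj x"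
proof -
  have "x ** (ginv x ** A ** pivot_inv x A) ** ker_proj x = 0"
    unfolding ginv_mult_pivot_inv[OF A] by (simp add: matrix_distribs x_ker_proj)
  then show ?thesis by (simp add: coker_proj_def matrix_distribs matrix_mul_assoc)
qed

text \<open>
  With \<open>dim_ker_ge_iff\<close> this flattens the stratum through \<open>x\<close>: in the chart it becomes the linear
  subspace of matrices whose lower right block vanishes.
\<close>

lemma corner_of_chart:
  assumes A: "A \<in> chart_domain x"
  shows "coker_proj x ** (A + corner x A) ** ker_proj x = A ** pivot_inv x A ** ker_proj x"
proof -
  have idem: "coker_proj x ** coker_proj x = coker_proj x"
    by (simp add: coker_proj_def matrix_distribs matrix_mul_assoc mult_ginv_mult ginv_mult_ginv)
  have "coker_proj x ** (A + corner x A) ** ker_proj x =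
      coker_proj x ** A ** ker_proj x +
      coker_proj x ** coker_proj x ** A ** ((mat 1 - ker_proj x) ** pivot_inv x A ** (ker_proj x ** ker_proj x))"
    by (simp add: corner_def matrix_add_ldistrib matrix_add_rdistrib' matrix_mul_assoc)
  also have "(mat 1 - ker_proj x) ** pivot_inv x A ** (ker_proj x ** ker_proj x) = pivot_inv x A ** ker_proj x - ker_proj x"
    by (simp add: ker_proj_idem matrix_diff_rdistrib ker_proj_pivot_inv[OF A])
  also have "coker_proj x ** A ** ker_proj x +
      coker_proj x ** coker_proj x ** A ** (pivot_inv x A ** ker_proj x - ker_proj x) =
      coker_proj x ** A ** pivot_inv x A ** ker_proj x"
    by (simp add: idem matrix_diff_ldistrib matrix_mul_assoc)
  finally show ?thesis using coker_proj_mult[OF A] by simp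
qed

lemma ginv_corner: "ginv x ** corner x A = 0" and corner_ker_proj: "corner x A ** (mat 1 - ker_proj x) = 0"
  subgoal by (simp add: corner_def matrix_mul_assoc ginv_coker_proj)
  subgoal by (simp add: corner_def matrix_mul_assoc[symmetric] matrix_diff_ldistrib ker_proj_idem)
  done

lemma pivot_shift: "ginv x ** Z = 0 \<Longrightarrow> pivot x (A + Z) = pivot x A"
  by (simp add: pivot_def matrix_distribs)

text \<open>
  The correction \<open>- c a\<^sup>-\<^sup>1 b\<close> does not see the lower right block. It takes values in that block, so
  subtracting it inverts the chart.
\<close>

lemma corner_shift: "ginv x ** Z = 0 \<Longrightarrow> Z ** (mat 1 - ker_proj x) = 0 \<Longrightarrow> corner x (A + Z) = corner x A"
  by (simp add: corner_def pivot_shift matrix_add_ldistrib matrix_add_rdistrib' matrix_mul_assoc[symmetric])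

lemma holo_corner:
  assumes "A \<in> chart_domain x" shows "holo_mat (corner x) A"
  unfolding corner_def by (intro holo_mat_mult holo_mat_const holo_mat_ident holo_pivot_inv assms)

lemma smooth_point_Sigma_bar:
  assumes r: "vec.dim (ker x) = r" shows "smooth_point (Sigma_bar r) x"
proof -
  let ?\<phi> = "\<lambda>A. A + corner x A" and ?\<psi> = "\<lambda>A. A - corner x A"
  let ?W = "{Y. coker_proj x ** Y ** ker_proj x = 0}"
  have neg_corner: "ginv x ** (- corner x A) = 0" "- corner x A ** (mat 1 - ker_proj x) = 0" for A
    using ginv_corner[of x A] corner_ker_proj[of x A] matrix_diff_ldistrib[of "ginv x" 0 "corner x A"]
      matrix_diff_rdistrib[of 0 "corner x A" "mat 1 - ker_proj x"]
    by simp_all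
  have maps: "?\<phi> A \<in> chart_domain x" "?\<psi> A \<in> chart_domain x" if "A \<in> chart_domain x" for A
    using that pivot_shift[OF ginv_corner[of x A], of A] pivot_shift[OF neg_corner(1)[of A], of A]
    by (simp_all add: chart_domain_def)
  have inv: "?\<psi> (?\<phi> A) = A" "?\<phi> (?\<psi> A) = A" for A
    using corner_shift[OF ginv_corner[of x A] corner_ker_proj, of A]
      corner_shift[OF neg_corner[of A], of A]
    by simp_all
  have chart_image: "?\<phi> ` chart_domain x = chart_domain x"
  proof
    show "chart_domain x \<subseteq> ?\<phi> ` chart_domain x" using maps(2) inv(2) by (metis (no_types, lifting) image_eqI subsetI)
  qed (use maps(1) in blast)
  have chart_Sigma_bar: "A \<in> Sigma_bar r \<longleftrightarrow> ?\<phi> A \<in> ?W" if "A \<in> chart_domain x" for A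
    using dim_ker_ge_iff[OF that] corner_of_chart[OF that] r by (simp add: Sigma_bar_def)
  show ?thesis
    unfolding smooth_point_def
  proof (intro conjI exI)
    show "x \<in> Sigma_bar r" using r by (simp add: Sigma_bar_def)
    show "open (chart_domain x)" "x \<in> chart_domain x" by (rule open_domain, rule x_in_domain)
    show "open (?\<phi> ` chart_domain x)" unfolding chart_image by (rule open_domain)
    show "holomorphic_mat_on ?\<phi> (chart_domain x)"
      by (intro holomorphic_mat_on_holo_mat holo_mat_add holo_mat_ident holo_corner)
    show "holomorphic_mat_on ?\<psi> (?\<phi> ` chart_domain x)" unfolding chart_image
      by (intro holomorphic_mat_on_holo_mat holo_mat_diff holo_mat_ident holo_corner)
    show "\<forall>y\<in>chart_domain x. ?\<psi> (?\<phi> y) = y" using inv by blast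
    have scale: "coker_proj x ** cscale c Y ** ker_proj x = cscale c (coker_proj x ** Y ** ker_proj x)" for c Y
      by (simp add: vec_eq_iff cscale_def matrix_matrix_mult_def sum_distrib_left sum_distrib_right mult_ac)
    show "cmat.subspace ?W"
      by (auto simp: cmat.subspace_def matrix_distribs scale)
    show "?\<phi> ` (Sigma_bar r \<inter> chart_domain x) = ?\<phi> ` chart_domain x \<inter> ?W" using chart_Sigma_bar by blast
  qed
qed

text \<open>
  Along a curve \<open>\<gamma>\<close> in \<open>Sigma_bar r\<close> the Schur complement vanishes, and \<open>L\<^sup>T x = 0\<close>, so the difference
  quotients of \<open>\<gamma>\<close> satisfy the relation \<open>?g t = 0\<close> below. In the limit the inverse pivot disappears,
  which leaves \<open>L\<^sup>T v\<close> restricted to the kernel of \<open>x\<close>, and the pairing is a trace of this.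
\<close>

lemma tangent_space_Sigma_bar:
  fixes x :: "complex ^ 'n ^ 'm"
  assumes r: "vec.dim (ker x) = r" and v: "v \<in> tangent_space (Sigma_bar r) x"
    and L: "x ** transpose L = 0" "transpose L ** x = 0"
  shows "mat_pairing L v = 0"
proof -
  obtain \<gamma> :: "real \<Rightarrow> complex ^ 'n ^ 'm" where \<gamma>: "\<gamma> 0 = x" "\<forall>\<^sub>F t in nhds 0. \<gamma> t \<in> Sigma_bar r"
    "(\<gamma> has_vector_derivative v) (at 0)"
    using v unfolding tangent_space_def by blast
  have cont: "isCont \<gamma> 0" using \<gamma>(3) has_vector_derivative_continuous by blast
  then have lim: "\<gamma> \<midarrow>0\<rightarrow> x" using \<gamma>(1) by (simp add: isCont_def)
  have evU: "\<forall>\<^sub>F t in at 0. \<gamma> t \<in> chart_domain x" using lim open_domain x_in_domain by (rule topological_tendstoD)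
  have evX: "\<forall>\<^sub>F t in at 0. \<gamma> t \<in> Sigma_bar r"
    using \<gamma>(2) by (simp add: eventually_at_filter eventually_mono)
  let ?D = "\<lambda>t. (1 / t) *\<^sub>R (\<gamma> t - x)"
  let ?g = "\<lambda>t. transpose L ** ?D t ** (pivot_inv x (\<gamma> t) ** ker_proj x)"
  have "?D \<midarrow>0\<rightarrow> v"
  proof -
    have "(\<lambda>t. (\<gamma> t - x - t *\<^sub>R v) /\<^sub>R \<bar>t\<bar>) \<midarrow>0\<rightarrow> 0"
      using \<gamma>(1,3) by (simp add: has_vector_derivative_def has_derivative_at_within)
    then have *: "(\<lambda>t. norm ((\<gamma> t - x - t *\<^sub>R v) /\<^sub>R \<bar>t\<bar>)) \<midarrow>0\<rightarrow> 0"
      by (rule tendsto_norm_zero)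
    have "norm ((\<gamma> t - x - t *\<^sub>R v) /\<^sub>R \<bar>t\<bar>) = norm (?D t - v)" if "t \<noteq> 0" for t
    proof -
      have "?D t - v = (1 / t) *\<^sub>R (\<gamma> t - x - t *\<^sub>R v)"
        using that by (simp add: scaleR_diff_right)
      then show ?thesis by (simp add: divide_inverse)
    qed
    then have "(\<lambda>t. norm (?D t - v)) \<midarrow>0\<rightarrow> 0"
      using Lim_transform_eventually[OF *] by (simp add: eventually_at_filter)
    then show ?thesis by (rule LIM_zero_cancel[OF tendsto_norm_zero_cancel])
  qed
  moreover have "(\<lambda>t. pivot_inv x (\<gamma> t)) \<midarrow>0\<rightarrow> mat 1"
    using isCont_tendsto_compose[OF holo_mat_continuous[OF holo_pivot_inv[OF x_in_domain]] lim]
    by (simp add: pivot_inv_x)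
  ultimately have g: "?g \<midarrow>0\<rightarrow> transpose L ** v ** (mat 1 ** ker_proj x)"
    by (intro tendsto_matrix_mult tendsto_const)
  have "\<forall>\<^sub>F t in at 0. ?g t = 0"
    using evU evX
  proof eventually_elim
    case (elim t)
    have "transpose L ** ?D t = (1 / t) *\<^sub>R (transpose L ** \<gamma> t)"
      by (simp only: scaleR_matrix_mult matrix_diff_ldistrib L(2) diff_0_right)
    then have "?g t = (1 / t) *\<^sub>R (transpose L ** (\<gamma> t ** pivot_inv x (\<gamma> t) ** ker_proj x))"
      by (simp only: matrix_mul_assoc scaleR_matrix_mult)
    moreover have "\<gamma> t ** pivot_inv x (\<gamma> t) ** ker_proj x = 0"
      using dim_ker_ge_iff[OF elim(1)] elim(2) r by (simp add: Sigma_bar_def)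
    ultimately show ?case by simp
  qed
  then have "?g \<midarrow>0\<rightarrow> 0" by (rule tendsto_eventually)
  then have "transpose L ** v ** ker_proj x = 0" using LIM_unique[OF g] by simp
  then have "trace (transpose L ** v ** ker_proj x) = 0" by (simp add: trace_def)
  moreover have "ker_proj x ** transpose L = transpose L"
    by (simp add: ker_proj_def matrix_diff_rdistrib matrix_mul_assoc[symmetric] L(1))
  then have "trace (transpose L ** v ** ker_proj x) = trace (transpose L ** v)"
    using trace_mul_sym[of "transpose L ** v" "ker_proj x"] by (simp add: matrix_mul_assoc)
  moreover have "trace (transpose L ** v) = mat_pairing L v"
    unfolding trace_def mat_pairing_def
    by (simp add: matrix_matrix_mult_def transpose_def) (rule sum.swap)
  ultimately show ?thesis by simp
qed

section \<open>Tangent hyperplanes of the rank strata\<close>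

text \<open>The kernel dimension can only drop on the domain of the chart at \<open>x\<close>.\<close>

lemma closed_Sigma_bar: "closed (Sigma_bar r :: (complex ^ 'n ^ 'm) set)"
proof -
  have "open (- Sigma_bar r :: (complex ^ 'n ^ 'm) set)"
    unfolding open_subopen[of "- Sigma_bar r"]
  proof
    fix x :: "complex ^ 'n ^ 'm" assume x: "x \<in> - Sigma_bar r"
    have "chart_domain x \<subseteq> - Sigma_bar r" using x dim_ker_le by (force simp: Sigma_bar_def)
    then show "\<exists>T. open T \<and> x \<in> T \<and> T \<subseteq> - Sigma_bar r" using open_domain x_in_domain by blast
  qed
  then show ?thesis by (simp add: closed_def)
qed

lemma mem_conormal_matrices_iff:
  "L \<in> conormal_matrices x \<longleftrightarrow> x ** transpose L = 0 \<and> transpose L ** x = 0"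
proof -
  have "(\<forall>i. row i L \<in> ker x) \<longleftrightarrow> x ** transpose L = 0"
    by (auto simp: ker_def vec_eq_iff row_def transpose_def matrix_matrix_mult_def matrix_vector_mult_def)
  moreover have "(\<Sum>i\<in>UNIV. column j L $ i * (x *v z) $ i) = ((transpose L ** x) *v z) $ j" for j z
    by (simp add: matrix_vector_mul_assoc[symmetric])
      (simp add: column_def vector_matrix_mult_def mult_ac)
  then have "(\<forall>j. column j L \<in> coker x) \<longleftrightarrow> (\<forall>z. (transpose L ** x) *v z = 0)"
    by (auto simp: coker_def vec_eq_iff)
  then have "(\<forall>j. column j L \<in> coker x) \<longleftrightarrow> transpose L ** x = 0" by (simp add: matrix_eq)
  ultimately show ?thesis by (auto simp: conormal_matrices_def)
qed

lemma mat_pairing_mult_left: "mat_pairing L (A ** x) = mat_pairing (L ** transpose x) A"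
proof -
  have "mat_pairing L (A ** x) = (\<Sum>i\<in>UNIV. \<Sum>j\<in>UNIV. \<Sum>k\<in>UNIV. L $ i $ j * (A $ i $ k * x $ k $ j))"
    by (simp add: mat_pairing_def matrix_matrix_mult_def sum_distrib_left)
  also have "\<dots> = (\<Sum>i\<in>UNIV. \<Sum>k\<in>UNIV. \<Sum>j\<in>UNIV. L $ i $ j * (A $ i $ k * x $ k $ j))"
    by (rule sum.cong[OF refl], rule sum.swap)
  also have "\<dots> = mat_pairing (L ** transpose x) A"
    by (simp add: mat_pairing_def matrix_matrix_mult_def transpose_def sum_distrib_right
        sum_distrib_left mult_ac)
  finally show ?thesis .
qed

lemma mat_pairing_mult_right: "mat_pairing L (x ** B) = mat_pairing (transpose x ** L) B"
proof -
  have "mat_pairing L (x ** B) = (\<Sum>i\<in>UNIV. \<Sum>j\<in>UNIV. \<Sum>k\<in>UNIV. L $ i $ j * (x $ i $ k * B $ k $ j))"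
    by (simp add: mat_pairing_def matrix_matrix_mult_def sum_distrib_left)
  also have "\<dots> = (\<Sum>i\<in>UNIV. \<Sum>k\<in>UNIV. \<Sum>j\<in>UNIV. L $ i $ j * (x $ i $ k * B $ k $ j))"
    by (rule sum.cong[OF refl], rule sum.swap)
  also have "\<dots> = (\<Sum>k\<in>UNIV. \<Sum>i\<in>UNIV. \<Sum>j\<in>UNIV. L $ i $ j * (x $ i $ k * B $ k $ j))"
    by (rule sum.swap)
  also have "\<dots> = (\<Sum>k\<in>UNIV. \<Sum>j\<in>UNIV. \<Sum>i\<in>UNIV. L $ i $ j * (x $ i $ k * B $ k $ j))"
    by (rule sum.cong[OF refl], rule sum.swap)
  also have "\<dots> = mat_pairing (transpose x ** L) B"
    by (simp add: mat_pairing_def matrix_matrix_mult_def transpose_def sum_distrib_right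
        sum_distrib_left mult_ac)
  finally show ?thesis .
qed

lemma transpose_zero: "transpose (0 :: 'a::zero ^ 'n ^ 'm) = 0"
  by (simp add: transpose_def vec_eq_iff)

definition unit_matrix :: "'m \<Rightarrow> 'n \<Rightarrow> complex ^ 'n ^ 'm" where
  "unit_matrix i j = (\<chi> p. if p = i then axis j 1 else 0)"

lemma mat_pairing_unit_matrix: "mat_pairing L (unit_matrix i j) = L $ i $ j"
proof -
  have "(\<Sum>q\<in>UNIV. L $ p $ q * unit_matrix i j $ p $ q) = (if p = i then L $ i $ j else 0)" for p
    by (simp add: unit_matrix_def axis_def if_distrib cong: if_cong)
  then show ?thesis by (simp add: mat_pairing_def)
qed

lemma mat_pairing_nondegenerate: "(\<And>B. mat_pairing L B = 0) \<Longrightarrow> L = 0"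
  using mat_pairing_unit_matrix[of L] by (simp add: vec_eq_iff)

lemma line_tangent:
  assumes "\<And>t::real. x + t *\<^sub>R v \<in> X"
  shows "v \<in> tangent_space X x"
proof -
  have "((\<lambda>t. x + t *\<^sub>R v) has_vector_derivative v) (at 0)"
    by (auto intro!: derivative_eq_intros)
  then show ?thesis unfolding tangent_space_def using assms
    by (intro CollectI exI[of _ "\<lambda>t. x + t *\<^sub>R v"]) simp
qed


lemma dim_ker_mult_left:
  fixes x :: "complex ^ 'n ^ 'm" and A :: "complex ^ 'm ^ 'p"
  shows "vec.dim (ker x) \<le> vec.dim (ker (A ** x))"
  by (rule vec.dim_subset) (auto simp: ker_def matrix_vector_mul_assoc[symmetric])

lemma dim_ker_mult_right:
  fixes x :: "complex ^ 'n ^ 'm" and B :: "complex ^ 'n ^ 'n"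
  shows "vec.dim (ker x) \<le> vec.dim (ker (x ** B))"
proof -
  have "range ((*v) (x ** B)) \<subseteq> range ((*v) x)" by (auto simp: matrix_vector_mul_assoc[symmetric])
  then have "vec.dim (range ((*v) (x ** B))) \<le> vec.dim (range ((*v) x))" by (rule vec.dim_subset)
  then show ?thesis using dim_ker[of x] dim_ker[of "x ** B"] by linarith
qed

lemma dim_ker_add_unit_matrix:
  fixes x :: "complex ^ 'n ^ 'm"
  shows "vec.dim (ker x) \<le> vec.dim (ker (x + t *\<^sub>R unit_matrix i j)) + 1"
proof -
  let ?E = "t *\<^sub>R unit_matrix i j :: complex ^ 'n ^ 'm"
  have "?E *v z = (of_real t * z $ j) *s axis i 1" for z
  proof -
    have "(?E *v z) $ p = ((of_real t * z $ j) *s axis i 1) $ p" for p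
    proof (cases "p = i")
      case True
      have "(?E *v z) $ i = (\<Sum>q\<in>UNIV. if q = j then of_real t * z $ j else 0)"
        unfolding matrix_vector_mult_def vec_lambda_beta
        by (rule sum.cong) (auto simp: unit_matrix_def axis_def scaleR_conv_of_real[where 'a=complex])
      then show ?thesis using True by (simp add: axis_def)
    next
      case False
      then show ?thesis by (simp add: matrix_vector_mult_def unit_matrix_def axis_def)
    qed
    then show ?thesis by (simp add: vec_eq_iff)
  qed
  then have "(*v) ?E ` ker x \<subseteq> vec.span {axis i 1}"
    by (auto intro!: vec.span_scale intro: vec.span_base)
  then have "vec.dim ((*v) ?E ` ker x) \<le> 1"
    using vec.dim_le_card[of "(*v) ?E ` ker x" "{axis i 1}"] by simp
  moreover have "vec.dim {z \<in> ker x. ?E *v z = 0} \<le> vec.dim (ker (x + ?E))"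
    by (rule vec.dim_subset) (auto simp: ker_def matrix_vector_mult_add_rdistrib)
  ultimately show ?thesis using rank_nullity[OF subspace_ker, of x ?E] by linarith
qed

text \<open>
  The necessary conditions come from straight lines in \<open>Sigma_bar r\<close> through \<open>x\<close>: those in the
  directions \<open>A x\<close> and \<open>x B\<close>, which stay inside because \<open>(1 + t A) x\<close> and \<open>x (1 + t B)\<close> have at most the
  rank of \<open>x\<close>, and, if the kernel rank exceeds \<open>r\<close>, also those in the directions of all matrix units.
  Only the converse needs the chart.
\<close>

lemma conormal_pair_iff:
  fixes x :: "complex ^ 'n ^ 'm"
  shows "smooth_point (Sigma_bar r) x \<and> tangent_hyperplane (Sigma_bar r) x L \<longleftrightarrow>
    vec.dim (ker x) = r \<and> L \<noteq> 0 \<and> L \<in> conormal_matrices x"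
proof (intro iffI conjI; elim conjE)
  assume "smooth_point (Sigma_bar r) x" and th: "tangent_hyperplane (Sigma_bar r) x L"
  then have x: "r \<le> vec.dim (ker x)" by (simp add: smooth_point_def Sigma_bar_def)
  show L0: "L \<noteq> 0" using th by (simp add: tangent_hyperplane_def)
  have pair: "mat_pairing L v = 0" if "\<And>t::real. x + t *\<^sub>R v \<in> Sigma_bar r" for v
    using line_tangent[of x v, OF that] th by (auto simp: tangent_hyperplane_def)
  show "vec.dim (ker x) = r"
  proof (rule ccontr)
    assume "vec.dim (ker x) \<noteq> r"
    then have "r + 1 \<le> vec.dim (ker x)" using x by simp
    then have "x + t *\<^sub>R unit_matrix i j \<in> Sigma_bar r" for t i j
      using dim_ker_add_unit_matrix[of x t i j] by (simp add: Sigma_bar_def)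
    then have "L $ i $ j = 0" for i j
      using pair[of "unit_matrix i j"] by (simp add: mat_pairing_unit_matrix)
    then show False using L0 by (simp add: vec_eq_iff)
  qed
  have "x + t *\<^sub>R (A ** x) \<in> Sigma_bar r" for t A
  proof -
    have "x + t *\<^sub>R (A ** x) = (mat 1 + t *\<^sub>R A) ** x"
      by (simp add: matrix_distribs scaleR_matrix_mult)
    then show ?thesis using x dim_ker_mult_left[of x "mat 1 + t *\<^sub>R A"] by (simp add: Sigma_bar_def)
  qed
  then have "mat_pairing (L ** transpose x) A = 0" for A
    using pair[of "A ** x"] by (simp add: mat_pairing_mult_left)
  then have "L ** transpose x = 0" by (rule mat_pairing_nondegenerate)
  then have 1: "x ** transpose L = 0"
    using matrix_transpose_mul[of L "transpose x"] by (simp add: transpose_zero)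
  have "x + t *\<^sub>R (x ** A) \<in> Sigma_bar r" for t A
  proof -
    have "x + t *\<^sub>R (x ** A) = x ** (mat 1 + t *\<^sub>R A)"
      by (simp add: matrix_distribs scaleR_matrix_mult)
    then show ?thesis using x dim_ker_mult_right[of x "mat 1 + t *\<^sub>R A"] by (simp add: Sigma_bar_def)
  qed
  then have "mat_pairing (transpose x ** L) A = 0" for A
    using pair[of "x ** A"] by (simp only: mat_pairing_mult_right)
  then have "transpose x ** L = 0" by (rule mat_pairing_nondegenerate)
  then have 2: "transpose L ** x = 0"
    using matrix_transpose_mul[of "transpose x" L] by (simp add: transpose_zero)
  show "L \<in> conormal_matrices x" using 1 2 by (simp add: mem_conormal_matrices_iff)
next
  assume r: "vec.dim (ker x) = r" and L: "L \<noteq> 0" "L \<in> conormal_matrices x"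
  show "smooth_point (Sigma_bar r) x" by (rule smooth_point_Sigma_bar[OF r])
  show "tangent_hyperplane (Sigma_bar r) x L"
    using L tangent_space_Sigma_bar[OF r] by (auto simp: tangent_hyperplane_def mem_conormal_matrices_iff)
qed

section \<open>From projective space to the cone of linear forms\<close>

lemma vector_space_cscale: "vector_space (cscale :: complex \<Rightarrow> complex ^ 'n ^ 'm \<Rightarrow> _)"
  by unfold_locales (simp_all add: cscale_def vec_eq_iff algebra_simps)

lemma span_singleton_cscale: "cmat.span {L} = range (\<lambda>c. cscale c L)"
  by (rule module.span_singleton) (use vector_space_cscale in \<open>simp only: module_iff_vector_space\<close>)

lemma cscale_cscale: "cscale c (cscale d L) = cscale (c * d) L"
  by (simp add: cscale_def vec_eq_iff)

lemma cscale_eq_0_iff: "cscale c L = 0 \<longleftrightarrow> c = 0 \<or> L = 0"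
  by (auto simp: cscale_def vec_eq_iff)

lemma cscale_1: "cscale 1 L = L"
  by (simp add: cscale_def vec_eq_iff)

lemma span_cscale:
  assumes "c \<noteq> 0" shows "cmat.span {cscale c L} = cmat.span {L}"
proof -
  have "cscale d L = cscale (d / c) (cscale c L)" for d using assms by (simp add: cscale_cscale)
  then have "range (\<lambda>d. cscale d L) \<subseteq> range (\<lambda>d. cscale d (cscale c L))" by blast
  moreover have "range (\<lambda>d. cscale d (cscale c L)) \<subseteq> range (\<lambda>d. cscale d L)"
    by (auto simp: cscale_cscale)
  ultimately show ?thesis by (simp add: span_singleton_cscale)
qed

lemma same_span:
  assumes "cmat.span {L} = cmat.span {L'}" "L' \<noteq> 0"
  obtains c where "c \<noteq> 0" "L' = cscale c L"
proof -
  have "L' \<in> range (\<lambda>c. cscale c L')" using cscale_1[of L'] by (metis rangeI)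
  then have "L' \<in> range (\<lambda>c. cscale c L)"
    using assms(1) by (simp only: span_singleton_cscale)
  then obtain c where "L' = cscale c L" by blast
  then show ?thesis using that assms(2) by (cases "c = 0") (auto simp: cscale_eq_0_iff)
qed

lemma continuous_cscale: "continuous_on UNIV (cscale c :: complex ^ 'n ^ 'm \<Rightarrow> _)"
  unfolding cscale_def by (intro continuous_intros)

lemma topspace_proj: "topspace proj_topology = projectivization (UNIV :: (complex ^ 'n ^ 'm) set)"
proof
  show "topspace proj_topology \<subseteq> projectivization (UNIV :: (complex ^ 'n ^ 'm) set)"
    using openin_topspace openin_proj_topology by blast
  have "{L :: complex ^ 'n ^ 'm. L \<noteq> 0 \<and> cmat.span {L} \<in> projectivization UNIV} = - {0}"
    by (auto simp: projectivization_def)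
  then have "openin proj_topology (projectivization (UNIV :: (complex ^ 'n ^ 'm) set))"
    unfolding openin_proj_topology by (simp only: open_Compl closed_singleton subset_refl)
  then show "projectivization (UNIV :: (complex ^ 'n ^ 'm) set) \<subseteq> topspace proj_topology"
    by (rule openin_subset)
qed

text \<open>
  The quotient map to projective space is open, because the saturation of an open set is a union of its
  rescalings.
\<close>

lemma openin_proj_projectivization:
  fixes S :: "(complex ^ 'n ^ 'm) set"
  assumes "open S" shows "openin proj_topology (projectivization S)"
  unfolding openin_proj_topology
proof
  show "projectivization S \<subseteq> projectivization UNIV" by (auto simp: projectivization_def)
  have "{L. L \<noteq> 0 \<and> cmat.span {L} \<in> projectivization S} = - {0} \<inter> (\<Union>c\<in>- {0}. cscale c -` S)"
  proof (intro equalityI subsetI)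
    fix L assume "L \<in> {L. L \<noteq> 0 \<and> cmat.span {L} \<in> projectivization S}"
    then obtain L' where L: "L \<noteq> 0" "cmat.span {L} = cmat.span {L'}" "L' \<in> S" "L' \<noteq> 0"
      by (auto simp: projectivization_def)
    then obtain c where "c \<noteq> 0" "L' = cscale c L" using same_span by metis
    then show "L \<in> - {0} \<inter> (\<Union>c\<in>- {0}. cscale c -` S)" using L by auto
  next
    fix L assume "L \<in> - {0} \<inter> (\<Union>c\<in>- {0}. cscale c -` S)"
    then obtain c where c: "L \<noteq> 0" "c \<noteq> 0" "cscale c L \<in> S" by auto
    then have "cmat.span {L} = cmat.span {cscale c L}" "cscale c L \<noteq> 0"
      by (simp_all add: span_cscale cscale_eq_0_iff)
    then show "L \<in> {L. L \<noteq> 0 \<and> cmat.span {L} \<in> projectivization S}"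
      using c unfolding projectivization_def by blast
  qed
  moreover have "open (cscale c -` S)" for c
    using continuous_open_vimage[OF assms] continuous_cscale[of c]
    by (metis continuous_on_eq_continuous_at open_UNIV UNIV_I)
  ultimately show "open {L. L \<noteq> 0 \<and> cmat.span {L} \<in> projectivization S}"
    by (simp only:) (intro open_Int open_UN open_Compl closed_singleton ballI)
qed

lemma mat_pairing_cscale: "mat_pairing (cscale c L) B = c * mat_pairing L B"
  by (simp add: mat_pairing_def cscale_def sum_distrib_left mult_ac)

lemma tangent_hyperplane_cscale:
  "c \<noteq> 0 \<Longrightarrow> tangent_hyperplane X x L \<Longrightarrow> tangent_hyperplane X x (cscale c L)"
  by (auto simp: tangent_hyperplane_def cscale_eq_0_iff mat_pairing_cscale)

text \<open>
  Since the quotient map is open and tangency is invariant under rescaling, the closure in the product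
  with projective space may be computed with the linear forms themselves, in a normed space. For
  \<open>L = 0\<close> this breaks down: the span of zero is not a point of projective space, while zero lies in the
  closure of every nonempty cone.
\<close>

lemma conormal_space_iff:
  fixes X :: "(complex ^ 'n ^ 'm) set"
  assumes x: "x \<in> X" and L: "L \<noteq> 0"
  shows "(x, cmat.span {L}) \<in> conormal_space X \<longleftrightarrow>
    (x, L) \<in> closure {(x', L'). smooth_point X x' \<and> tangent_hyperplane X x' L'}"
    (is "_ \<longleftrightarrow> _ \<in> closure ?A")
proof
  assume *: "(x, cmat.span {L}) \<in> conormal_space X"
  show "(x, L) \<in> closure ?A"
    unfolding closure_iff_nhds_not_empty
  proof (intro allI impI)
    fix N O' assume N: "O' \<subseteq> N" "open O'" "(x, L) \<in> O'"
    obtain O1 O2 where O: "open O1" "open O2" "(x, L) \<in> O1 \<times> O2" "O1 \<times> O2 \<subseteq> O'"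
      by (rule open_prod_elim[OF N(2,3)])
    let ?T = "(X \<inter> O1) \<times> projectivization O2"
    have "openin (prod_topology (top_of_set X) proj_topology) ?T"
      using O by (simp add: openin_prod_Times_iff openin_proj_projectivization openin_open_Int)
    moreover have "(x, cmat.span {L}) \<in> ?T" using x L O by (auto simp: projectivization_def)
    ultimately have "\<exists>y. y \<in> {(x, cmat.span {L}) |x L. smooth_point X x \<and> tangent_hyperplane X x L} \<and> y \<in> ?T"
      using * unfolding conormal_space_def in_closure_of by (elim conjE allE impE) (rule conjI)
    then obtain x' L'' where s: "smooth_point X x'" "tangent_hyperplane X x' L''"
      and T: "x' \<in> O1" "cmat.span {L''} \<in> projectivization O2"
      by auto
    obtain L' where L': "cmat.span {L''} = cmat.span {L'}" "L' \<in> O2" "L' \<noteq> 0"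
      using T(2) by (auto simp: projectivization_def)
    then obtain c where "c \<noteq> 0" "L' = cscale c L''" using same_span by metis
    then have "(x', L') \<in> ?A" using s tangent_hyperplane_cscale by auto
    moreover have "(x', L') \<in> N" using O(4) N(1) T(1) L'(2) by blast
    ultimately show "?A \<inter> N \<noteq> {}" by blast
  qed
next
  assume *: "(x, L) \<in> closure ?A"
  show "(x, cmat.span {L}) \<in> conormal_space X"
    unfolding conormal_space_def in_closure_of
  proof (intro conjI allI impI)
    show "(x, cmat.span {L}) \<in> topspace (prod_topology (top_of_set X) proj_topology)"
      using x L by (auto simp: topspace_proj projectivization_def)
    fix T assume "(x, cmat.span {L}) \<in> T \<and> openin (prod_topology (top_of_set X) proj_topology) T"
    then obtain U V where UV: "openin (top_of_set X) U" "openin proj_topology V" "x \<in> U"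
      "cmat.span {L} \<in> V" "U \<times> V \<subseteq> T"
      unfolding openin_prod_topology_alt by blast
    obtain O1 where O1: "open O1" "U = X \<inter> O1" using UV(1) by (auto simp: openin_open)
    let ?O2 = "{L. L \<noteq> 0 \<and> cmat.span {L} \<in> V}"
    have "open (O1 \<times> ?O2)" using O1 UV(2) by (simp add: open_Times openin_proj_topology)
    moreover have "(x, L) \<in> O1 \<times> ?O2" using O1 UV L by auto
    ultimately have "(O1 \<times> ?O2) \<inter> ?A \<noteq> {}" using * open_Int_closure_eq_empty by blast
    then obtain x' L' where "(x', L') \<in> ?A" "x' \<in> O1" "cmat.span {L'} \<in> V" by blast
    moreover from this have "x' \<in> X" by (simp add: smooth_point_def)
    ultimately show "\<exists>y. y \<in> {(x, cmat.span {L}) |x L. smooth_point X x \<and> tangent_hyperplane X x L} \<and> y \<in> T"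
      using UV(5) O1(2) by blast
  qed
qed

lemma conormal_fiber_eq:
  fixes X :: "(complex ^ 'n ^ 'm) set"
  assumes x: "x \<in> X"
  shows "conormal_fiber X x =
    projectivization {L. (x, L) \<in> closure {(x', L'). smooth_point X x' \<and> tangent_hyperplane X x' L'}}"
    (is "_ = projectivization ?C")
proof (intro equalityI subsetI)
  fix p assume p: "p \<in> conormal_fiber X x"
  then have "p \<in> topspace proj_topology"
    unfolding conormal_fiber_def conormal_space_def in_closure_of by simp
  then obtain L where "p = cmat.span {L}" "L \<noteq> 0" by (auto simp: topspace_proj projectivization_def)
  then show "p \<in> projectivization ?C"
    using p conormal_space_iff[OF x] by (auto simp: projectivization_def conormal_fiber_def)
next
  fix p assume "p \<in> projectivization ?C"
  then show "p \<in> conormal_fiber X x"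
    using conormal_space_iff[OF x] by (auto simp: projectivization_def conormal_fiber_def)
qed

section \<open>Limits of conormal pairs\<close>

(* Products with a transposed matrix stay in the form transpose A *v y, to match ker (transpose A). *)
declare transpose_matrix_vector [simp del]

lemma subspace_range: "vec.subspace (range ((*v) A))"
  by (rule vec.subspace_image[OF vec.subspace_UNIV])

lemma closed_orthogonality:
  "closed {(x :: complex ^ 'n ^ 'm, L). L \<in> conormal_matrices x}"
proof -
  have "continuous_on UNIV (\<lambda>p :: (complex ^ 'n ^ 'm) \<times> (complex ^ 'n ^ 'm). fst p ** transpose (snd p))"
    "continuous_on UNIV (\<lambda>p :: (complex ^ 'n ^ 'm) \<times> (complex ^ 'n ^ 'm). transpose (snd p) ** fst p)"
    unfolding matrix_matrix_mult_def transpose_def by (intro continuous_intros)+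
  then have "closed {p :: (complex ^ 'n ^ 'm) \<times> (complex ^ 'n ^ 'm).
      fst p ** transpose (snd p) = 0 \<and> transpose (snd p) ** fst p = 0}"
    by (intro closed_Collect_conj closed_Collect_eq continuous_on_const)
  then show ?thesis by (simp add: mem_conormal_matrices_iff case_prod_unfold)
qed

lemma conormal_matrices_ranges:
  assumes "L \<in> conormal_matrices x"
  shows "range ((*v) (transpose L)) \<subseteq> ker x" "range ((*v) x) \<subseteq> ker (transpose L)"
  using assms by (auto simp: mem_conormal_matrices_iff ker_def matrix_vector_mul_assoc)

lemma dim_range_conormal_le:
  assumes "L \<in> conormal_matrices x"
  shows "vec.dim (range ((*v) L)) \<le> vec.dim (ker x)"
  using vec.dim_subset[OF conormal_matrices_ranges(1)[OF assms]] dim_range_transpose[of L] by simp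

text \<open>
  The rank of \<open>L\<close> is expressed as a kernel dimension, so that \<open>closed_Sigma_bar\<close> also gives the closedness
  of the rank condition. For the converse, the perturbed matrix must kill the rows of \<open>L\<close> and take
  values in the annihilator \<open>?W\<close> of its columns, so that \<open>L\<close> is conormal along the whole curve.
\<close>

lemma closure_conormal_pairs:
  fixes M L :: "complex ^ 'n ^ 'm"
  assumes nm: "CARD('n) \<le> CARD('m)" and M: "r < vec.dim (ker M)" and L: "L \<noteq> 0"
  shows "(M, L) \<in> closure {(x, L). vec.dim (ker x) = r \<and> L \<noteq> 0 \<and> L \<in> conormal_matrices x} \<longleftrightarrow>
    L \<in> conormal_matrices M \<and> vec.dim (range ((*v) L)) \<le> r"
    (is "_ \<in> closure ?A \<longleftrightarrow> _")
proof
  let ?Z = "{(x :: complex ^ 'n ^ 'm, L). L \<in> conormal_matrices x} \<inter> UNIV \<times> Sigma_bar (CARD('n) - r)"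
  have rank_iff: "vec.dim (range ((*v) L)) \<le> r \<longleftrightarrow> L \<in> Sigma_bar (CARD('n) - r)" for L :: "complex ^ 'n ^ 'm"
    using dim_ker[of L] by (auto simp: Sigma_bar_def)
  have "?A \<subseteq> ?Z" using dim_range_conormal_le rank_iff by fastforce
  moreover have "closed ?Z"
    by (intro closed_Int closed_orthogonality closed_Times closed_UNIV closed_Sigma_bar)
  ultimately have "closure ?A \<subseteq> ?Z" by (rule closure_minimal)
  moreover assume "(M, L) \<in> closure ?A"
  ultimately show "L \<in> conormal_matrices M \<and> vec.dim (range ((*v) L)) \<le> r" using rank_iff by blast
next
  assume *: "L \<in> conormal_matrices M \<and> vec.dim (range ((*v) L)) \<le> r"
  let ?R = "range ((*v) (transpose L))"
  have R: "vec.subspace ?R" by (rule subspace_range)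
  obtain S where S: "vec.subspace S" "?R \<subseteq> S" "S \<subseteq> ker M" "vec.dim S = r"
    using exists_subspace_between[OF R subspace_ker, of M r] conormal_matrices_ranges(1)[of L M] * M
      dim_range_transpose[of L] by auto
  let ?W = "ker (transpose L)"
  have "vec.dim ?W + vec.dim ?R = CARD('m)" by (rule dim_ker)
  then have "CARD('m) \<le> r + vec.dim ?W" using * dim_range_transpose[of L] by linarith
  then have dims: "vec.dim (UNIV :: (complex ^ 'n) set) \<le> vec.dim S + vec.dim ?W"
    using nm S(4) by (simp only: vec_dim_card)
  have MW: "M *v z \<in> ?W" for z using conormal_matrices_ranges(2) * by blast
  have MS: "M *v z = 0" if "z \<in> S" for z using S(3) that by (auto simp: ker_def)
  obtain N where N: "\<And>z. N *v z \<in> ?W" "\<And>t. t \<noteq> 0 \<Longrightarrow> {z. M *v z + t *s (N *v z) = 0} = S"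
    using exists_kernel_perturbation[OF vec.subspace_UNIV subspace_ker MW S(1) subset_UNIV MS dims]
    by auto
  let ?x = "\<lambda>t::complex. M + cscale t N"
  have xv: "?x t *v z = M *v z + t *s (N *v z)" for t z
    by (simp add: vec_eq_iff matrix_vector_mult_def cscale_def algebra_simps sum.distrib sum_distrib_left)
  have "(?x t, L) \<in> ?A" if "t \<noteq> 0" for t
  proof -
    have kerx: "ker (?x t) = S" using N(2)[OF that] by (simp add: ker_def xv)
    have "transpose L ** M = 0" using * by (simp add: mem_conormal_matrices_iff)
    then have "transpose L *v (M *v z) = 0" for z by (simp add: matrix_vector_mul_assoc)
    then have "transpose L *v (?x t *v z) = 0" for z
      using N(1)[of z] by (simp add: xv ker_def matrix_vector_right_distrib vector_scalar_commute)
    then have "transpose L ** ?x t = 0" by (simp add: matrix_eq matrix_vector_mul_assoc[symmetric])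
    moreover have "?x t *v (transpose L *v z) = 0" for z
      using S(2) kerx by (auto simp: ker_def)
    then have "?x t ** transpose L = 0" by (simp add: matrix_eq matrix_vector_mul_assoc[symmetric])
    ultimately show ?thesis using kerx S(4) L by (simp add: mem_conormal_matrices_iff)
  qed
  then have "(?x t, L) \<in> closure ?A" if "t \<noteq> 0" for t
    using that by (intro subsetD[OF closure_subset])
  then have "\<forall>\<^sub>F t in at 0. (?x t, L) \<in> closure ?A"
    by (simp add: eventually_at_filter)
  moreover have "((\<lambda>t. (?x t, L)) \<longlongrightarrow> (?x 0, L)) (at 0)"
    unfolding cscale_def by (intro tendsto_intros)
  moreover have "?x 0 = M" by simp
  ultimately show "(M, L) \<in> closure ?A"
    using Lim_in_closed_set[OF closed_closure, of "\<lambda>t. (?x t, L)" ?A "at 0" "(?x 0, L)"] by simp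
qed

section \<open>Linear maps from the kernel to the cokernel\<close>

text \<open>
  Elements of \<open>Hom_ker_coker M\<close> are undefined off the kernel of \<open>M\<close>. Extending them to a matrix makes the
  results on matrices available.
\<close>

lemma Hom_ker_coker_matrix:
  assumes f: "f \<in> Hom_ker_coker M" and B: "is_basis_of B (ker M)"
  obtains F where "\<And>x. x \<in> ker M \<Longrightarrow> F *v x = f x"
proof -
  have ind: "vec.independent B" and sp: "vec.span B = ker M" using B by (auto simp: is_basis_of_def)
  have fin: "finite B" using ind by (rule vec.finiteI_independent)
  have Bk: "B \<subseteq> ker M" using vec.span_superset[of B] sp by simp
  obtain g where g: "Vector_Spaces.linear (*s) (*s) g" "\<forall>b\<in>B. g b = f b"
    using vec.linear_independent_extend[OF ind] by blast
  obtain F where F: "\<And>x. F *v x = g x" using matrix_of_linear[OF g(1)] by blast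
  have "F *v x = f x" if x: "x \<in> ker M" for x
  proof -
    have x: "(\<Sum>b\<in>B. vec.representation B x b *s b) = x"
      using vec.sum_representation_eq[OF ind _ fin order_refl] x sp by simp
    have "f x = (\<Sum>b\<in>B. vec.representation B x b *s f b)"
      using Hom_ker_coker_sum[OF f fin Bk, of "vec.representation B x"] unfolding x by blast
    also have "\<dots> = (\<Sum>b\<in>B. vec.representation B x b *s (F *v b))"
      using F g(2) by simp
    also have "\<dots> = F *v (\<Sum>b\<in>B. vec.representation B x b *s b)"
      by (simp add: vec.linear_sum[OF matrix_vector_mul_linear_gen] vector_scalar_commute)
    finally show ?thesis using x by simp
  qed
  then show ?thesis by (rule that)
qed

lemma exists_dual_vector:
  fixes B :: "('a::field ^ 'n) set"
  assumes "vec.independent B"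
  obtains d where "\<And>b'. b' \<in> B \<Longrightarrow> (\<Sum>j\<in>UNIV. b' $ j * d $ j) = (if b' = b then 1 else 0)"
proof -
  \<comment> \<open>The dual vector is row \<open>i\<close> of a matrix, for an arbitrary index \<open>i\<close>.\<close>
  fix i :: 'n
  obtain g :: "'a ^ 'n \<Rightarrow> 'a ^ 'n" where g: "Vector_Spaces.linear (*s) (*s) g"
      "\<forall>b'\<in>B. g b' = (if b' = b then axis i 1 else 0)"
    using vec.linear_independent_extend[OF assms, of "\<lambda>b'. if b' = b then axis i 1 else 0"] by blast
  obtain D where D: "\<And>x. D *v x = g x" using matrix_of_linear[OF g(1)] by blast
  have "(\<Sum>j\<in>UNIV. b' $ j * D $ i $ j) = (if b' = b then 1 else 0)" if "b' \<in> B" for b'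
  proof -
    have "(D *v b') $ i = (if b' = b then axis i 1 else 0) $ i" using D g(2) that by simp
    then show ?thesis by (simp add: matrix_vector_mult_def mult.commute split: if_splits)
  qed
  then show ?thesis by (rule that)
qed

text \<open>
  The matrix sends \<open>x\<close> to a combination of the vectors \<open>f b\<close>, and the dual vector of \<open>b\<close> to \<open>f b\<close> itself.
  Hence \<open>f\<close> and its matrix have the same rank.
\<close>

lemma range_hom_to_matrix:
  assumes f: "f \<in> Hom_ker_coker M" and B: "is_basis_of B (ker M)"
  shows "range ((*v) (hom_to_matrix B f)) = f ` ker M"
proof -
  have ind: "vec.independent B" and sp: "vec.span B = ker M" using B by (auto simp: is_basis_of_def)
  have fin: "finite B" using ind by (rule vec.finiteI_independent)
  have Bk: "B \<subseteq> ker M" using vec.span_superset[of B] sp by simp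
  obtain F where F: "\<And>x. x \<in> ker M \<Longrightarrow> F *v x = f x" using Hom_ker_coker_matrix[OF f B] by blast
  have fk: "f ` ker M = vec.span (f ` B)"
  proof -
    have "f ` ker M = (*v) F ` vec.span B" using F sp by simp
    also have "\<dots> = vec.span ((*v) F ` B)"
      by (rule vec.linear_span_image[OF matrix_vector_mul_linear_gen, symmetric])
    also have "(*v) F ` B = f ` B" using F Bk by force
    finally show ?thesis .
  qed
  have L: "hom_to_matrix B f *v x = (\<Sum>b\<in>B. (\<Sum>j\<in>UNIV. b $ j * x $ j) *s f b)" for x
  proof -
    have "(hom_to_matrix B f *v x) $ i = (\<Sum>b\<in>B. (\<Sum>j\<in>UNIV. b $ j * x $ j) *s f b) $ i" for i
      unfolding matrix_vector_mult_def hom_to_matrix_nth vec_lambda_beta sum_distrib_right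
      by (subst sum.swap) (simp add: sum_distrib_right sum_distrib_left mult_ac)
    then show ?thesis by (simp add: vec_eq_iff)
  qed
  show ?thesis
  proof
    show "range ((*v) (hom_to_matrix B f)) \<subseteq> f ` ker M"
      unfolding fk by (auto simp: L intro!: vec.span_sum vec.span_scale intro: vec.span_base)
    have "f b \<in> range ((*v) (hom_to_matrix B f))" if b: "b \<in> B" for b
    proof -
      obtain d where d: "\<And>b'. b' \<in> B \<Longrightarrow> (\<Sum>j\<in>UNIV. b' $ j * d $ j) = (if b' = b then 1 else 0)"
        using exists_dual_vector[OF ind] by blast
      have "hom_to_matrix B f *v d = (\<Sum>b'\<in>B. if b' = b then f b' else 0)"
        unfolding L by (rule sum.cong) (auto simp: d)
      then have "f b = hom_to_matrix B f *v d" using b fin by simp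
      then show ?thesis by blast
    qed
    then show "f ` ker M \<subseteq> range ((*v) (hom_to_matrix B f))"
      unfolding fk by (intro vec.span_minimal subspace_range) blast
  qed
qed

lemma dim_ker_Hom:
  assumes f: "f \<in> Hom_ker_coker M" and B: "is_basis_of B (ker M)"
  shows "vec.dim {x \<in> ker M. f x = 0} + vec.dim (range ((*v) (hom_to_matrix B f))) = vec.dim (ker M)"
proof -
  obtain F where F: "\<And>x. x \<in> ker M \<Longrightarrow> F *v x = f x" using Hom_ker_coker_matrix[OF f B] by blast
  have "{x \<in> ker M. F *v x = 0} = {x \<in> ker M. f x = 0}" "(*v) F ` ker M = f ` ker M" using F by auto
  then show ?thesis using rank_nullity[OF subspace_ker, of M F] range_hom_to_matrix[OF f B] by simp
qed

lemma coker_eq: "coker M = ker (transpose M)"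
proof -
  have "(\<Sum>i\<in>UNIV. y $ i * (M *v x) $ i) = (\<Sum>j\<in>UNIV. (transpose M *v y) $ j * x $ j)" for y x
    unfolding matrix_vector_mult_def transpose_def vec_lambda_beta sum_distrib_left sum_distrib_right
    by (subst sum.swap) (simp add: mult_ac)
  then have "y \<in> coker M \<longleftrightarrow> (\<forall>x. (\<Sum>j\<in>UNIV. (transpose M *v y) $ j * x $ j) = 0)" for y
    by (simp add: coker_def)
  moreover have "(\<forall>x. (\<Sum>j\<in>UNIV. z $ j * x $ j) = 0) \<longleftrightarrow> z = 0" for z :: "complex ^ 'n"
  proof
    assume *: "\<forall>x. (\<Sum>j\<in>UNIV. z $ j * x $ j) = 0"
    have "z $ i = 0" for i using *[rule_format, of "axis i 1"]
      by (simp add: axis_def if_distrib cong: if_cong)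
    then show "z = 0" by (simp add: vec_eq_iff)
  qed simp
  ultimately show ?thesis by (auto simp: ker_def)
qed

lemma closed_ker: "closed (ker A)"
  unfolding ker_def matrix_vector_mult_def by (intro closed_Collect_eq continuous_intros)

lemma closed_Hom_ker_coker: "closed (Hom_ker_coker (M :: complex ^ 'n ^ 'm))"
proof -
  have eval: "continuous_on UNIV (\<lambda>f :: complex ^ 'n \<Rightarrow> complex ^ 'm. f x)" for x
    by (rule continuous_on_product_coordinates)
  have scale: "continuous_on UNIV (\<lambda>f :: complex ^ 'n \<Rightarrow> complex ^ 'm. c *s f x)" for c x
    unfolding vector_scalar_mult_def by (intro continuous_intros eval)
  have "Hom_ker_coker M = (\<Inter>x\<in>ker M. (\<lambda>f. f x) -` coker M) \<inter> (\<Inter>x\<in>- ker M. {f. f x = undefined})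
    \<inter> (\<Inter>x\<in>ker M. \<Inter>y\<in>ker M. {f. f (x + y) = f x + f y})
    \<inter> (\<Inter>c. \<Inter>x\<in>ker M. {f. f (c *s x) = c *s f x})"
    by (auto simp: Hom_ker_coker_def PiE_def extensional_def)
  also have "closed \<dots>"
    unfolding coker_eq
    by (intro closed_Int closed_INT ballI closed_Collect_eq continuous_on_add eval scale
        continuous_on_const closed_vimage closed_ker)
  finally show ?thesis .
qed

lemma continuous_hom_to_matrix: "continuous_on UNIV (hom_to_matrix B)"
  unfolding hom_to_matrix_def
  by (intro continuous_intros continuous_on_product_coordinates)

text \<open>
  The maps of rank at most \<open>r\<close> form a closed set because \<open>hom_to_matrix\<close> is continuous for pointwise
  convergence. Each such map \<open>f\<close> is a limit of maps \<open>f + t N\<close> of rank exactly \<open>r\<close>; this perturbation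
  needs a cokernel of dimension at least \<open>r\<close>, which the bound on the number of columns provides.
\<close>

lemma Sigma_bar_at_eq:
  fixes M :: "complex ^ 'n ^ 'm"
  assumes nm: "CARD('n) \<le> CARD('m)" and B: "is_basis_of B (ker M)" and r: "r \<le> vec.dim (ker M)"
  shows "Sigma_bar_at M (vec.dim (ker M) - r) =
    {f \<in> Hom_ker_coker M. vec.dim (range ((*v) (hom_to_matrix B f))) \<le> r}"
    (is "_ = ?R")
proof
  let ?s = "vec.dim (ker M)"
  have "Sigma_eq_at M (?s - r) \<subseteq> ?R"
    using dim_ker_Hom[OF _ B] r by (fastforce simp: Sigma_eq_at_def)
  moreover have "closed ?R"
  proof -
    have "vec.dim (range ((*v) L)) \<le> r \<longleftrightarrow> L \<in> Sigma_bar (CARD('n) - r)" for L :: "complex ^ 'n ^ 'm"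
      using dim_ker[of L] by (auto simp: Sigma_bar_def)
    then have "?R = Hom_ker_coker M \<inter> hom_to_matrix B -` Sigma_bar (CARD('n) - r)" by auto
    moreover have "closed (hom_to_matrix B -` (Sigma_bar (CARD('n) - r) :: (complex ^ 'n ^ 'm) set))"
      by (rule closed_vimage[OF closed_Sigma_bar continuous_hom_to_matrix])
    ultimately show ?thesis by (simp only: closed_Int[OF closed_Hom_ker_coker])
  qed
  ultimately show "Sigma_bar_at M (?s - r) \<subseteq> ?R"
    unfolding Sigma_bar_at_def by (rule closure_minimal)
  show "?R \<subseteq> Sigma_bar_at M (?s - r)"
  proof
    fix f assume "f \<in> ?R"
    then have f: "f \<in> Hom_ker_coker M" and rk: "vec.dim (range ((*v) (hom_to_matrix B f))) \<le> r" by auto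
    obtain F where F: "\<And>x. x \<in> ker M \<Longrightarrow> F *v x = f x" using Hom_ker_coker_matrix[OF f B] by blast
    let ?K = "{x \<in> ker M. F *v x = 0}"
    have K: "vec.subspace ?K"
      using subspace_ker[of M]
      by (auto simp: vec.subspace_def matrix_vector_right_distrib vector_scalar_commute)
    have "?K = {x \<in> ker M. f x = 0}" using F by auto
    then have "?s - r \<le> vec.dim ?K" using dim_ker_Hom[OF f B] rk by simp
    then obtain S where S: "vec.subspace S" "S \<subseteq> vec.span ?K" "vec.dim S = ?s - r"
      using vec.choose_subspace_of_subspace by blast
    have SK: "S \<subseteq> ?K" using S(2) vec.span_minimal[OF order_refl K] by (rule subset_trans)
    have "vec.dim (coker M) + vec.dim (range ((*v) (transpose M))) = CARD('m)"
      unfolding coker_eq by (rule dim_ker)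
    then have dims: "?s \<le> vec.dim S + vec.dim (coker M)"
      using S(3) dim_ker[of M] dim_range_transpose[of M] nm by linarith
    have FM: "F *v x \<in> coker M" if "x \<in> ker M" for x
      using F[OF that] f that by (auto simp: Hom_ker_coker_def)
    have FS: "F *v x = 0" if "x \<in> S" for x using SK that by blast
    have SM: "S \<subseteq> ker M" using SK by blast
    obtain N where N: "\<And>x. x \<in> ker M \<Longrightarrow> N *v x \<in> coker M"
      "\<And>t. t \<noteq> 0 \<Longrightarrow> {x \<in> ker M. F *v x + t *s (N *v x) = 0} = S"
      using exists_kernel_perturbation[OF subspace_ker subspace_coker FM S(1) SM FS dims] by auto
    define g where "g t = restrict (\<lambda>x. F *v x + t *s (N *v x)) (ker M)" for t
    have gH: "g t \<in> Sigma_eq_at M (?s - r)" if "t \<noteq> 0" for t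
    proof -
      have add: "x + y \<in> ker M" if "x \<in> ker M" "y \<in> ker M" for x y
        using vec.subspace_add[OF subspace_ker] that .
      have scale: "c *s x \<in> ker M" if "x \<in> ker M" for c x
        using vec.subspace_scale[OF subspace_ker that] .
      have "F *v x + t *s (N *v x) \<in> coker M" if "x \<in> ker M" for x
        by (rule vec.subspace_add[OF subspace_coker FM[OF that] vec.subspace_scale[OF subspace_coker N(1)[OF that]]])
      then have "g t \<in> Hom_ker_coker M"
        unfolding Hom_ker_coker_def g_def
        by (auto simp: add scale matrix_vector_right_distrib vector_scalar_commute vec.scale_right_distrib
            mult.commute)
      moreover have "{x \<in> ker M. g t x = 0} = S" unfolding N(2)[OF that, symmetric] by (auto simp: g_def)
      ultimately show ?thesis using S(3) by (simp add: Sigma_eq_at_def)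
    qed
    have "g 0 x = f x" for x
      using F f by (cases "x \<in> ker M") (auto simp: g_def Hom_ker_coker_def)
    then have g0: "g 0 = f" by blast
    have "continuous_on UNIV g"
    proof (rule continuous_on_coordinatewise_then_product)
      fix x
      show "continuous_on UNIV (\<lambda>t. g t x)"
        by (cases "x \<in> ker M") (auto simp: g_def vector_scalar_mult_def intro!: continuous_intros)
    qed
    then have "(g \<longlongrightarrow> g 0) (at 0)" by (simp add: continuous_on_def)
    then have "(g \<longlongrightarrow> f) (at 0)" by (simp only: g0)
    moreover have "g t \<in> closure (Sigma_eq_at M (?s - r))" if "t \<noteq> 0" for t
      using gH[OF that] by (rule subsetD[OF closure_subset])
    then have "\<forall>\<^sub>F t in at 0. g t \<in> closure (Sigma_eq_at M (?s - r))"
      by (simp add: eventually_at_filter)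
    ultimately show "f \<in> Sigma_bar_at M (?s - r)"
      unfolding Sigma_bar_at_def
      using Lim_in_closed_set[OF closed_closure, of g _ "at 0" f] by simp
  qed
qed

section \<open>The fiber of the conormal space\<close>

lemma conormal_fiber_Sigma_bar:
  fixes M :: "complex ^ 'n ^ 'm"
  assumes nm: "CARD('n) \<le> CARD('m)" and M: "r < vec.dim (ker M)"
  shows "conormal_fiber (Sigma_bar r) M =
    projectivization {L \<in> conormal_matrices M. vec.dim (range ((*v) L)) \<le> r}"
proof -
  have "M \<in> Sigma_bar r" using M by (simp add: Sigma_bar_def)
  then have "conormal_fiber (Sigma_bar r) M = projectivization
     {L. (M, L) \<in> closure {(x, L). vec.dim (ker x) = r \<and> L \<noteq> 0 \<and> L \<in> conormal_matrices x}}"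
    by (simp only: conormal_fiber_eq conormal_pair_iff)
  then show ?thesis
    using closure_conormal_pairs[OF nm M] unfolding projectivization_def by auto
qed

lemma X_at_eq:
  fixes M :: "complex ^ 'n ^ 'm"
  assumes nm: "CARD('n) \<le> CARD('m)" and B: "is_basis_of B (ker M)" and r: "r \<le> vec.dim (ker M)"
  shows "X_at B M (vec.dim (ker M) - r) =
    projectivization {L \<in> conormal_matrices M. vec.dim (range ((*v) L)) \<le> r}"
proof -
  have "hom_to_matrix B ` Sigma_bar_at M (vec.dim (ker M) - r) =
      {L \<in> conormal_matrices M. vec.dim (range ((*v) L)) \<le> r}"
    using bij_betw_hom_to_matrix[OF B] unfolding Sigma_bar_at_eq[OF assms] bij_betw_def by auto
  then show ?thesis by (simp add: X_at_def)
qed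

theorem proposition2p6:
  fixes M :: "complex ^ 'n ^ 'm" and B :: "(complex ^ 'n) set" and k r s :: nat
  assumes "CARD('m) = CARD('n) + k"
    and "M \<in> Sigma_eq s"
    and "s > r"
    and "is_basis_of B (ker M)"
  shows "conormal_fiber (Sigma_bar r) M = X_at B M (s - r)"
proof -
  have s: "vec.dim (ker M) = s" using assms(2) by (simp add: Sigma_eq_def)
  have nm: "CARD('n) \<le> CARD('m)" using assms(1) by simp
  show ?thesis
    using conormal_fiber_Sigma_bar[OF nm, of r M] X_at_eq[OF nm assms(4), of r] s assms(3) by simp
qed

end
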